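(* Let $B$ be a separable Banach space, $\chi$ a Chi-subspace of $(B\hat{\otimes}_{\pi}B)^{\ast}$, and let $\mathbb X^{1},\mathbb X^{2}$ be two continuous $B$-valued stochastic processes indexed by $[0,T]$ such that, for every $i,j\in\{1,2\}$, $\mathbb X^{i}$ and $\mathbb X^{j}$ admit a $\chi$-covariation. Let $F^{1},F^{2}:B\to\mathbb R$ be of class $C^{1}$ in the Fréchet sense and suppose that, for $i,j\in\{1,2\}$, the maps $$B\times B\to\chi,\qquad (x,y)\mapsto DF^{i}(x)\otimes DF^{j}(y)$$ are well defined (i.e. take values in $\chi$) and continuous. Then for every $i,j\in\{1,2\}$ the covariation of the real processes $F^{i}(\mathbb X^{i})$ and $F^{j}(\mathbb X^{j})$ exists and $$[F^{i}(\mathbb X^{i}),F^{j}(\mathbb X^{j})]_t=\int_{0}^{t}\langle DF^{i}(\mathbb X^{i}_{s})\otimes DF^{j}(\mathbb X^{j}_{s}),d\widetilde{[\mathbb X^{i},\mathbb X^{j}]}_{s}\rangle,\quad t\in[0,T].$$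
   Context: Fix a probability space $(\Omega,\mathcal F,\mathbb P)$ and $T>0$. All processes indexed by $[0,T]$ are extended by $\mathbb X_t=\mathbb X_0$ for $t\le0$ and $\mathbb X_t=\mathbb X_T$ for $t\ge T$. Real covariation: for real processes $X,Y$ with $X$ continuous, set $[X,Y]^{\epsilon}_t=\int_0^t\frac{(X_{s+\epsilon}-X_s)(Y_{s+\epsilon}-Y_s)}{\epsilon}ds$; $X,Y$ admit a covariation if for each $t$ the limit in probability of $[X,Y]^\epsilon_t$ as $\epsilon\to0$ exists and the limit process has a continuous modification, denoted $[X,Y]$. For Banach spaces $B_1,B_2$, $B_1\hat\otimes_\pi B_2$ is the projective tensor product; its dual is identified with bounded bilinear forms on $B_1\times B_2$. A Chi-subspace is a Banach space $\chi$ continuously injected into $(B_1\hat\otimes_\pi B_2)^*$. For $S,T\in B^*$, $S\otimes T$ denotes the unique continuous linear form on $B\hat\otimes_\pi B$ with $S\otimes T(e_1\otimes e_2)=S(e_1)T(e_2)$. $\chi$-covariation: let $\mathbb X$ be continuous $B_1$-valued and $\mathbb Y$ strongly measurable $B_2$-valued with $\int_0^T\|\mathbb Y_s\|ds<\infty$ a.s. For $\phi\in\chi$ set $[\mathbb X,\mathbb Y]^\epsilon(\phi)_t=\int_0^t\langle\phi,\frac{(\mathbb X_{s+\epsilon}-\mathbb X_s)\otimes(\mathbb Y_{s+\epsilon}-\mathbb Y_s)}{\epsilon}\rangle ds$. $\mathbb X,\mathbb Y$ admit a $\chi$-covariation if (H1) for every sequence $\epsilon_n\to0$ there is a subsequence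 $(\epsilon_{n_k})$ with $\sup_k\int_0^T\frac{\|(\mathbb X_{s+\epsilon_{n_k}}-\mathbb X_s)\otimes(\mathbb Y_{s+\epsilon_{n_k}}-\mathbb Y_s)\|_{\chi^*}}{\epsilon_{n_k}}ds<\infty$ a.s.; and (H2) there is a map $\phi\mapsto[\mathbb X,\mathbb Y](\phi)$ from $\chi$ into continuous real processes with $[\mathbb X,\mathbb Y]^\epsilon(\phi)\to[\mathbb X,\mathbb Y](\phi)$ uniformly on $[0,T]$ in probability for every $\phi\in\chi$, and a measurable $\chi^*$-valued process $\widetilde{[\mathbb X,\mathbb Y]}$ whose paths are a.s. cadlag with bounded variation and such that $\widetilde{[\mathbb X,\mathbb Y]}_t(\phi)=[\mathbb X,\mathbb Y](\phi)_t$ a.s. for all $\phi\in\chi$, $t\in[0,T]$. $\widetilde{[\mathbb X,\mathbb Y]}$ is called the $\chi$-covariation. Integrals $\int_0^t\langle H_s,d\widetilde{[\mathbb X,\mathbb Y]}_s\rangle$ are pathwise Stieltjes (Bochner) integrals of the $\chi$-valued integrand against the $\chi^*$-valued bounded variation path. *)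

theory Defs
  imports "HOL-Probability.Probability"
begin

definition ext_proc :: "real \<Rightarrow> (real \<Rightarrow> 'w \<Rightarrow> 'a) \<Rightarrow> real \<Rightarrow> 'w \<Rightarrow> 'a" where
  "ext_proc T X t = X (max 0 (min t T))"

definition cont_process :: "'w measure \<Rightarrow> real \<Rightarrow> (real \<Rightarrow> 'w \<Rightarrow> 'a::topological_space) \<Rightarrow> bool" where
  "cont_process M T X \<longleftrightarrow>
     (\<forall>t\<in>{0..T}. X t \<in> borel_measurable M) \<and>
     (\<forall>\<omega>\<in>space M. continuous_on {0..T} (\<lambda>t. X t \<omega>))"

section \<open>Convergence in probability (outer-probability formulation)\<close>

definition conv_in_prob :: "'w measure \<Rightarrow> ('e \<Rightarrow> 'w \<Rightarrow> real) \<Rightarrow> ('w \<Rightarrow> real) \<Rightarrow> 'e filter \<Rightarrow> bool" where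
  "conv_in_prob M Z L F \<longleftrightarrow>
     (\<forall>\<delta>>0. \<forall>\<eta>>0. eventually (\<lambda>e. \<exists>A\<in>sets M.
        {\<omega>\<in>space M. \<delta> \<le> \<bar>Z e \<omega> - L \<omega>\<bar>} \<subseteq> A \<and> measure M A < \<eta>) F)"

definition unif_conv_in_prob :: "'w measure \<Rightarrow> real \<Rightarrow> ('e \<Rightarrow> real \<Rightarrow> 'w \<Rightarrow> real) \<Rightarrow> (real \<Rightarrow> 'w \<Rightarrow> real) \<Rightarrow> 'e filter \<Rightarrow> bool" where
  "unif_conv_in_prob M T Z L F \<longleftrightarrow>
     (\<forall>\<delta>>0. \<forall>\<eta>>0. eventually (\<lambda>e. \<exists>A\<in>sets M.
        {\<omega>\<in>space M. \<exists>t\<in>{0..T}. \<delta> \<le> \<bar>Z e t \<omega> - L t \<omega>\<bar>} \<subseteq> A \<and> measure M A < \<eta>) F)"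

definition real_cov_eps :: "real \<Rightarrow> (real \<Rightarrow> 'w \<Rightarrow> real) \<Rightarrow> (real \<Rightarrow> 'w \<Rightarrow> real) \<Rightarrow> real \<Rightarrow> real \<Rightarrow> 'w \<Rightarrow> real" where
  "real_cov_eps T X Y \<epsilon> t \<omega> =
     integral {0..t} (\<lambda>s. (ext_proc T X (s + \<epsilon>) \<omega> - ext_proc T X s \<omega>) *
                          (ext_proc T Y (s + \<epsilon>) \<omega> - ext_proc T Y s \<omega>) / \<epsilon>)"

text \<open>C is (a continuous modification of) the covariation [X,Y]: C has continuous paths and
  for every t, [X,Y]^eps_t converges to C t in probability as eps tends to 0+.\<close>
definition is_real_covariation :: "'w measure \<Rightarrow> real \<Rightarrow> (real \<Rightarrow> 'w \<Rightarrow> real) \<Rightarrow> (real \<Rightarrow> 'w \<Rightarrow> real) \<Rightarrow> (real \<Rightarrow> 'w \<Rightarrow> real) \<Rightarrow> bool" where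
  "is_real_covariation M T X Y C \<longleftrightarrow>
     cont_process M T C \<and>
     (\<forall>t\<in>{0..T}. conv_in_prob M (\<lambda>\<epsilon>. real_cov_eps T X Y \<epsilon> t) (C t) (at_right 0))"

text \<open>A Chi-subspace: a Banach space 'c continuously injected (via iota) into the dual of the
  projective tensor product, i.e. into the bounded bilinear forms on B x B.\<close>
definition chi_subspace :: "('c::banach \<Rightarrow> 'b::banach \<Rightarrow> 'b \<Rightarrow> real) \<Rightarrow> bool" where
  "chi_subspace \<iota> \<longleftrightarrow>
     (\<forall>a b. linear (\<lambda>\<phi>. \<iota> \<phi> a b)) \<and> inj \<iota> \<and>
     (\<forall>\<phi>. bounded_bilinear (\<iota> \<phi>)) \<and>
     (\<exists>K. \<forall>\<phi> a b. \<bar>\<iota> \<phi> a b\<bar> \<le> K * norm \<phi> * norm a * norm b)"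

definition chi_tensor :: "('c::banach \<Rightarrow> 'b::banach \<Rightarrow> 'b \<Rightarrow> real) \<Rightarrow> 'b \<Rightarrow> 'b \<Rightarrow> 'c \<Rightarrow>\<^sub>L real" where
  "chi_tensor \<iota> a b = Blinfun (\<lambda>\<phi>. \<iota> \<phi> a b)"

definition cadlag_on :: "real \<Rightarrow> real \<Rightarrow> (real \<Rightarrow> 'a::metric_space) \<Rightarrow> bool" where
  "cadlag_on a b f \<longleftrightarrow>
     (\<forall>t\<in>{a..<b}. (f \<longlongrightarrow> f t) (at_right t)) \<and>
     (\<forall>t\<in>{a<..b}. \<exists>l. (f \<longlongrightarrow> l) (at_left t))"

definition bounded_variation_on :: "real \<Rightarrow> real \<Rightarrow> (real \<Rightarrow> 'a::real_normed_vector) \<Rightarrow> bool" where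
  "bounded_variation_on a b f \<longleftrightarrow>
     (\<exists>K. \<forall>(n::nat) (p::nat \<Rightarrow> real). p 0 = a \<and> p n = b \<and> (\<forall>k<n. p k \<le> p (Suc k)) \<longrightarrow>
        (\<Sum>k<n. norm (f (p (Suc k)) - f (p k))) \<le> K)"

definition has_rs_integral :: "(real \<Rightarrow> 'c::real_normed_vector) \<Rightarrow> (real \<Rightarrow> 'c \<Rightarrow>\<^sub>L real) \<Rightarrow> real \<Rightarrow> real \<Rightarrow> real \<Rightarrow> bool" where
  "has_rs_integral H A a b I \<longleftrightarrow>
     (\<forall>e>0. \<exists>\<delta>>0. \<forall>(n::nat) (p::nat \<Rightarrow> real) (\<xi>::nat \<Rightarrow> real).
        p 0 = a \<and> p n = b \<and> (\<forall>k<n. p k \<le> \<xi> k \<and> \<xi> k \<le> p (Suc k) \<and> p (Suc k) - p k < \<delta>) \<longrightarrow>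
        \<bar>(\<Sum>k<n. blinfun_apply (A (p (Suc k)) - A (p k)) (H (\<xi> k))) - I\<bar> < e)"

definition chi_cov_eps :: "real \<Rightarrow> ('c \<Rightarrow> 'b \<Rightarrow> 'b \<Rightarrow> real) \<Rightarrow> (real \<Rightarrow> 'w \<Rightarrow> 'b::real_normed_vector) \<Rightarrow> (real \<Rightarrow> 'w \<Rightarrow> 'b) \<Rightarrow> 'c \<Rightarrow> real \<Rightarrow> real \<Rightarrow> 'w \<Rightarrow> real" where
  "chi_cov_eps T \<iota> X Y \<phi> \<epsilon> t \<omega> =
     integral {0..t} (\<lambda>s. \<iota> \<phi> (ext_proc T X (s + \<epsilon>) \<omega> - ext_proc T X s \<omega>)
                              (ext_proc T Y (s + \<epsilon>) \<omega> - ext_proc T Y s \<omega>) / \<epsilon>)"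

text \<open>X, Y admit the chi-covariation Tl, with associated processes Cov phi = [X,Y](phi).\<close>
definition is_chi_covariation ::
  "'w measure \<Rightarrow> real \<Rightarrow> ('c::banach \<Rightarrow> 'b::banach \<Rightarrow> 'b \<Rightarrow> real) \<Rightarrow> (real \<Rightarrow> 'w \<Rightarrow> 'b) \<Rightarrow> (real \<Rightarrow> 'w \<Rightarrow> 'b)
   \<Rightarrow> ('c \<Rightarrow> real \<Rightarrow> 'w \<Rightarrow> real) \<Rightarrow> (real \<Rightarrow> 'w \<Rightarrow> ('c \<Rightarrow>\<^sub>L real)) \<Rightarrow> bool" where
  "is_chi_covariation M T \<iota> X Y Cov Tl \<longleftrightarrow>
     \<comment> \<open>(H1)\<close>
     (\<forall>\<epsilon>::nat \<Rightarrow> real. (\<forall>n. \<epsilon> n > 0) \<and> \<epsilon> \<longlonglongrightarrow> 0 \<longrightarrow>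
        (\<exists>r::nat \<Rightarrow> nat. strict_mono r \<and>
           (AE \<omega> in M. (SUP k. \<integral>\<^sup>+ s. indicator {0..T} s *
               ennreal (norm (chi_tensor \<iota> (ext_proc T X (s + \<epsilon> (r k)) \<omega> - ext_proc T X s \<omega>)
                                         (ext_proc T Y (s + \<epsilon> (r k)) \<omega> - ext_proc T Y s \<omega>)) / \<epsilon> (r k)) \<partial>lborel) < (\<top>::ennreal)))) \<and>
     \<comment> \<open>(H2)\<close>
     (\<forall>\<phi>. cont_process M T (Cov \<phi>) \<and>
          unif_conv_in_prob M T (\<lambda>\<epsilon>. chi_cov_eps T \<iota> X Y \<phi> \<epsilon>) (Cov \<phi>) (at_right 0)) \<and>
     (\<lambda>(t, \<omega>). Tl t \<omega>) \<in> borel_measurable (restrict_space borel {0..T} \<Otimes>\<^sub>M M) \<and>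
     (AE \<omega> in M. cadlag_on 0 T (\<lambda>t. Tl t \<omega>) \<and> bounded_variation_on 0 T (\<lambda>t. Tl t \<omega>)) \<and>
     (\<forall>\<phi>. \<forall>t\<in>{0..T}. AE \<omega> in M. blinfun_apply (Tl t \<omega>) \<phi> = Cov \<phi> t \<omega>)"

end

theory Submission
  imports Defs
begin

text \<open>
  By the mean value theorem, each product of increments of \<open>F X\<close> and \<open>G Y\<close> over a time step
  \<open>\<epsilon>\<close> is the pairing of the elementary tensor of the increments of \<open>X\<close> and \<open>Y\<close> with \<open>DF \<otimes> DG\<close>
  at a nearby point. Freezing that point at \<open>(X s, Y s)\<close> costs a modulus of continuity times the
  \<open>\<chi>\<^sup>*\<close>-norm bounded by (H1). The path \<open>s \<mapsto> DF (X s) \<otimes> DG (Y s)\<close> is then replaced by a step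
  path, again at the cost of a modulus of continuity times the same norm, and for a step path the
  limit is given by (H2). Since \<open>B\<close> is separable, all integrands lie in the closure of one countable
  subset of \<open>\<chi>\<close>, so (H2) may be used almost surely for all of them at once, along a subsequence.
  Convergence in probability follows because the initial sequence was arbitrary.
\<close>

section \<open>Riemann--Stieltjes sums against operator-valued paths of bounded variation\<close>

text \<open>Three points shape the details. The path of \<open>Tl\<close> is only cadlag in norm,
  while a covariation must have continuous paths. Its pairing with each element of the countable set
  agrees with a continuous process, so possible jumps vanish on the closure where the integrand
  lives; the integral is then a uniform limit of sums that are continuous in \<open>t\<close>. Next,
  \<chi> may be non-separable, so the pairing of a random functional with a random element of \<chi>
  is not obviously measurable; as the integrand is a continuous function of two points of
  \<open>B\<close>, measurability is obtained by approximating these points. Finally, the points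
  supplied by the mean value theorem lie off the two paths, and balls of \<open>B\<close> need not
  be compact; a modulus of continuity near the compact image of the paths replaces uniform
  continuity on a compact set. The integral is constructed as a limit along fixed grids, which gives
  existence, measurability and uniformity in \<open>t\<close> together.\<close>

definition tagged_partition :: "real \<Rightarrow> real \<Rightarrow> nat \<Rightarrow> (nat \<Rightarrow> real) \<Rightarrow> (nat \<Rightarrow> real) \<Rightarrow> bool" where
  "tagged_partition t \<delta> n p \<xi> \<longleftrightarrow>
     p 0 = 0 \<and> p n = t \<and> (\<forall>k<n. p k \<le> \<xi> k \<and> \<xi> k \<le> p (Suc k) \<and> p (Suc k) - p k < \<delta>)"

definition rs_sum :: "(real \<Rightarrow> 'c::real_normed_vector) \<Rightarrow> (real \<Rightarrow> 'c \<Rightarrow>\<^sub>L real) \<Rightarrow> nat \<Rightarrow> (nat \<Rightarrow> real) \<Rightarrow> (nat \<Rightarrow> real) \<Rightarrow> real" where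
  "rs_sum H A n p \<xi> = (\<Sum>k<n. blinfun_apply (A (p (Suc k)) - A (p k)) (H (\<xi> k)))"

lemma has_rs_integral_iff:
  "has_rs_integral H A 0 t I \<longleftrightarrow>
     (\<forall>e>0. \<exists>\<delta>>0. \<forall>n p \<xi>. tagged_partition t \<delta> n p \<xi> \<longrightarrow> \<bar>rs_sum H A n p \<xi> - I\<bar> < e)"
  unfolding has_rs_integral_def tagged_partition_def rs_sum_def by simp

lemma partition_mono:
  fixes p :: "nat \<Rightarrow> real"
  assumes "\<forall>k<n. p k \<le> p (Suc k)" "i \<le> j" "j \<le> n"
  shows "p i \<le> p j"
  using assms(2,3,1)
proof (induction j rule: dec_induct)
  case (step j)
  then show ?case by (metis Suc_le_eq Suc_leD order_trans)
qed simp

text \<open>The function \<open>v\<close> is the total variation on \<open>{0..t}\<close>, and the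
  bound holds because a partition of \<open>{0..r}\<close> extends by the cell from \<open>r\<close>
  to \<open>s\<close>. Later estimates see the path only through \<open>v\<close>, whose increments
  telescope.\<close>

lemma bounded_variation_dominated:
  fixes A :: "real \<Rightarrow> 'a::real_normed_vector"
  assumes "bounded_variation_on 0 T A" "0 \<le> T"
  obtains v where "\<And>r s. 0 \<le> r \<Longrightarrow> r \<le> s \<Longrightarrow> s \<le> T \<Longrightarrow> norm (A s - A r) \<le> v s - v r"
proof -
  define W where "W t = {\<Sum>k<n. norm (A (p (Suc k)) - A (p k)) | n p.
     p 0 = 0 \<and> p n = t \<and> (\<forall>k<n. p k \<le> p (Suc k))}" for t
  obtain K where K: "\<And>n p. p 0 = 0 \<Longrightarrow> p n = T \<Longrightarrow> (\<forall>k<n. p k \<le> p (Suc k)) \<Longrightarrow>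
        (\<Sum>k<n. norm (A (p (Suc k)) - A (p k))) \<le> K"
    using assms(1) unfolding bounded_variation_on_def by blast
  have ext: "x + norm (A s - A r) \<in> W s" if x: "x \<in> W r" and rs: "r \<le> s" for x r s
  proof -
    obtain n p where p: "x = (\<Sum>k<n. norm (A (p (Suc k)) - A (p k)))"
      "p 0 = 0" "p n = r" "\<forall>k<n. p k \<le> p (Suc k)"
      using x unfolding W_def by blast
    define q where "q = p(Suc n := s)"
    have "(\<Sum>k<Suc n. norm (A (q (Suc k)) - A (q k))) = x + norm (A s - A r)"
      using p by (simp add: q_def)
    moreover have "q 0 = 0" "q (Suc n) = s" "\<forall>k<Suc n. q k \<le> q (Suc k)"
      using p rs by (auto simp: q_def less_Suc_eq)
    ultimately show ?thesis unfolding W_def by (intro CollectI exI[of _ "Suc n"] exI[of _ q] conjI) (simp only:)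
  qed
  \<comment> \<open>The bound \<open>K\<close> covers only partitions that end at \<open>T\<close>,
    so a last cell from \<open>t\<close> to \<open>T\<close> is appended.\<close>
  have bd: "x \<le> K" if "x \<in> W t" "t \<le> T" for x t
  proof -
    have "x + norm (A T - A t) \<in> W T" by (rule ext[OF that])
    then obtain n p where "x + norm (A T - A t) = (\<Sum>k<n. norm (A (p (Suc k)) - A (p k)))"
      "p 0 = 0" "p n = T" "\<forall>k<n. p k \<le> p (Suc k)"
      unfolding W_def by blast
    then have "x + norm (A T - A t) \<le> K" using K by simp
    then show ?thesis using norm_ge_zero[of "A T - A t"] by linarith
  qed
  have ne: "W t \<noteq> {}" if "0 \<le> t" for t
  proof -
    have "0 \<in> W 0" unfolding W_def by (auto intro!: exI[of _ 0] exI[of _ "\<lambda>_. 0"])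
    from ext[OF this that] show ?thesis by blast
  qed
  show ?thesis
  proof (rule that[of "\<lambda>t. Sup (W t)"])
    fix r s assume rs: "0 \<le> r" "r \<le> s" "s \<le> T"
    have bddW: "bdd_above (W s)" using bd rs unfolding bdd_above_def by blast
    have "x \<le> Sup (W s) - norm (A s - A r)" if "x \<in> W r" for x
      using cSup_upper[OF ext[OF that rs(2)] bddW] by simp
    then have "Sup (W r) \<le> Sup (W s) - norm (A s - A r)"
      using ne[OF rs(1)] by (intro cSup_least) auto
    then show "norm (A s - A r) \<le> Sup (W s) - Sup (W r)" by simp
  qed
qed

text \<open>\<open>max a (min b d)\<close> is the projection of \<open>d\<close> onto
  \<open>{a..b}\<close>. Both sides are the increment of \<open>f\<close> over the intersection of
  \<open>{a..b}\<close> and \<open>{c..d}\<close>; when the intervals are disjoint, both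
  vanish.\<close>

lemma increment_clamp_swap:
  fixes f :: "real \<Rightarrow> 'a::ab_group_add"
  assumes "a \<le> b" "c \<le> d"
  shows "f (max a (min b d)) - f (max a (min b c)) = f (max c (min d b)) - f (max c (min d a))"
  using assms by (auto simp: max_def min_def)

lemma increment_refine:
  fixes f :: "real \<Rightarrow> 'a::ab_group_add"
  assumes "0 \<le> a" "a \<le> b" "b \<le> t" "q 0 = 0" "q m = t"
  shows "f b - f a = (\<Sum>l<m. f (max a (min b (q (Suc l)))) - f (max a (min b (q l))))"
proof -
  have "max a (min b (q m)) = b" "max a (min b (q 0)) = a"
    using assms by auto
  then show ?thesis
    using sum_lessThan_telescope[of "\<lambda>l. f (max a (min b (q l)))" m] by metis
qed

text \<open>Refining each cell of one partition by the other one expresses both sums over the same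
  pairs of cells, so no common refinement has to be constructed.\<close>

lemma rs_sum_diff_le:
  fixes H :: "real \<Rightarrow> 'c::real_normed_vector"
  assumes v: "\<And>r s. 0 \<le> r \<Longrightarrow> r \<le> s \<Longrightarrow> s \<le> t \<Longrightarrow> norm (A s - A r) \<le> v s - v r"
    and P: "tagged_partition t \<delta> n p \<xi>" and Q: "tagged_partition t \<delta>' m q \<eta>"
    and osc: "\<And>x y. x \<in> {0..t} \<Longrightarrow> y \<in> {0..t} \<Longrightarrow> \<bar>x - y\<bar> \<le> \<delta> + \<delta>' \<Longrightarrow> norm (H x - H y) \<le> e"
  shows "\<bar>rs_sum H A n p \<xi> - rs_sum H A m q \<eta>\<bar> \<le> e * (v t - v 0)"
proof -
  define P' where "P' k l = max (p k) (min (p (Suc k)) (q l))" for k l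
  define Q' where "Q' l k = max (q l) (min (q (Suc l)) (p k))" for l k
  have pm: "p i \<le> p j" if "i \<le> j" "j \<le> n" for i j
    using P that unfolding tagged_partition_def by (intro partition_mono) (auto intro: order_trans)
  have qm: "q i \<le> q j" if "i \<le> j" "j \<le> m" for i j
    using Q that unfolding tagged_partition_def by (intro partition_mono) (auto intro: order_trans)
  have p0: "p 0 = 0" "p n = t" and q0: "q 0 = 0" "q m = t"
    using P Q unfolding tagged_partition_def by auto
  have pr: "0 \<le> p k" "p k \<le> p (Suc k)" "p (Suc k) \<le> t" if "k < n" for k
    using pm[of 0 k] pm[of k "Suc k"] pm[of "Suc k" n] that p0 by auto
  have qr: "0 \<le> q k" "q k \<le> q (Suc k)" "q (Suc k) \<le> t" if "k < m" for k
    using qm[of 0 k] qm[of k "Suc k"] qm[of "Suc k" m] that q0 by auto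
  have incp: "f (p (Suc k)) - f (p k) = (\<Sum>l<m. f (P' k (Suc l)) - f (P' k l))" if "k < n"
    for k and f :: "real \<Rightarrow> 'z::ab_group_add"
    unfolding P'_def using increment_refine[OF pr[OF that] q0] .
  have incq: "f (q (Suc l)) - f (q l) = (\<Sum>k<n. f (Q' l (Suc k)) - f (Q' l k))" if "l < m"
    for l and f :: "real \<Rightarrow> 'z::ab_group_add"
    unfolding Q'_def using increment_refine[OF qr[OF that] p0] .
  have swap: "f (Q' l (Suc k)) - f (Q' l k) = f (P' k (Suc l)) - f (P' k l)" if "k < n" "l < m"
    for k l and f :: "real \<Rightarrow> 'z::ab_group_add"
    unfolding P'_def Q'_def by (rule increment_clamp_swap) (use pr qr that in auto)
  define D where "D k l = A (P' k (Suc l)) - A (P' k l)" for k l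
  have S1: "rs_sum H A n p \<xi> = (\<Sum>k<n. \<Sum>l<m. D k l (H (\<xi> k)))"
    unfolding rs_sum_def D_def
    by (intro sum.cong refl) (simp add: incp[of _ A] blinfun.sum_left)
  have "rs_sum H A m q \<eta> = (\<Sum>l<m. \<Sum>k<n. D k l (H (\<eta> l)))"
    unfolding rs_sum_def D_def
    by (intro sum.cong refl) (simp add: incq[of _ A] blinfun.sum_left swap[of _ _ A])
  also have "\<dots> = (\<Sum>k<n. \<Sum>l<m. D k l (H (\<eta> l)))" by (rule sum.swap)
  finally have "rs_sum H A n p \<xi> - rs_sum H A m q \<eta> = (\<Sum>k<n. \<Sum>l<m. D k l (H (\<xi> k) - H (\<eta> l)))"
    by (simp add: S1 sum_subtractf blinfun.diff_right)
  also have "\<bar>\<dots>\<bar> \<le> (\<Sum>k<n. \<Sum>l<m. \<bar>D k l (H (\<xi> k) - H (\<eta> l))\<bar>)"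
    by (rule order_trans[OF sum_abs sum_mono[OF sum_abs]])
  also have "\<dots> \<le> (\<Sum>k<n. \<Sum>l<m. e * (v (P' k (Suc l)) - v (P' k l)))"
  proof (intro sum_mono)
    fix k l assume "k \<in> {..<n}" "l \<in> {..<m}"
    then have kl: "k < n" "l < m" by auto
    note pr' = pr[OF kl(1)] and qr' = qr[OF kl(2)]
    have le: "P' k l \<le> P' k (Suc l)" "0 \<le> P' k l" "P' k (Suc l) \<le> t"
      unfolding P'_def using pr' qr' by auto
    have nD: "norm (D k l) \<le> v (P' k (Suc l)) - v (P' k l)"
      unfolding D_def using v le by blast
    show "\<bar>D k l (H (\<xi> k) - H (\<eta> l))\<bar> \<le> e * (v (P' k (Suc l)) - v (P' k l))"
    \<comment> \<open>Cells that do not overlap may carry tags far apart, but then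
      \<open>D k l\<close> is zero. Cells that overlap in an interval of positive length have tags
      at distance at most the sum of the two meshes.\<close>
    proof (cases "P' k l = P' k (Suc l)")
      case True
      then show ?thesis by (simp add: D_def)
    next
      case False
      then have "p k < q (Suc l)" "q l < p (Suc k)"
        unfolding P'_def using pr' qr' by (auto simp: max_def min_def split: if_splits)
      moreover have "p k \<le> \<xi> k" "\<xi> k \<le> p (Suc k)" "p (Suc k) - p k < \<delta>"
        "q l \<le> \<eta> l" "\<eta> l \<le> q (Suc l)" "q (Suc l) - q l < \<delta>'"
        using P Q kl unfolding tagged_partition_def by auto
      ultimately have "norm (H (\<xi> k) - H (\<eta> l)) \<le> e"
        using pr' qr' by (intro osc) auto
      then have "norm (D k l) * norm (H (\<xi> k) - H (\<eta> l)) \<le> (v (P' k (Suc l)) - v (P' k l)) * e"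
        using nD norm_ge_zero[of "D k l"] by (intro mult_mono norm_ge_zero) linarith+
      then show ?thesis
        using norm_blinfun[of "D k l" "H (\<xi> k) - H (\<eta> l)"] by (simp add: mult.commute)
    qed
  qed
  also have "\<dots> = e * (\<Sum>k<n. v (p (Suc k)) - v (p k))"
    by (simp add: sum_distrib_left[symmetric] incp[of _ v])
  also have "\<dots> = e * (v t - v 0)"
    using sum_lessThan_telescope[of "\<lambda>k. v (p k)" n] by (simp only: p0)
  finally show ?thesis .
qed

lemma uniform_mod_continuity:
  fixes H :: "real \<Rightarrow> 'c::metric_space"
  assumes "continuous_on {0..T} H" "e > 0"
  obtains d where "d > 0" "\<And>x y. x \<in> {0..T} \<Longrightarrow> y \<in> {0..T} \<Longrightarrow> \<bar>x - y\<bar> \<le> d \<Longrightarrow> dist (H x) (H y) < e"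
proof -
  have "uniformly_continuous_on {0..T} H"
    using assms by (intro compact_uniformly_continuous) auto
  then obtain d where d: "d > 0" "\<And>x y. x \<in> {0..T} \<Longrightarrow> y \<in> {0..T} \<Longrightarrow> dist y x < d \<Longrightarrow> dist (H y) (H x) < e"
    using assms(2) unfolding uniformly_continuous_on_def by metis
  then show ?thesis
    by (intro that[of "d/2"]) (auto simp: dist_real_def)
qed

text \<open>The Cauchy form needs no candidate for the integral. The width \<open>d\<close> does not
  depend on the horizon \<open>t\<close>, because \<open>v t - v 0\<close> is at most
  \<open>v T - v 0\<close>; this is the source of all uniformity in \<open>t\<close>.\<close>

lemma rs_sum_uniformly_Cauchy:
  fixes H :: "real \<Rightarrow> 'c::real_normed_vector"
  assumes v: "\<And>r s. 0 \<le> r \<Longrightarrow> r \<le> s \<Longrightarrow> s \<le> T \<Longrightarrow> norm (A s - A r) \<le> v s - v r"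
    and H: "continuous_on {0..T} H" and "e > 0"
  obtains d where "d > 0"
    "\<And>t n p \<xi> m q \<eta>. t \<in> {0..T} \<Longrightarrow> tagged_partition t d n p \<xi> \<Longrightarrow> tagged_partition t d m q \<eta> \<Longrightarrow>
       \<bar>rs_sum H A n p \<xi> - rs_sum H A m q \<eta>\<bar> \<le> e"
proof (cases "0 \<le> T")
  case True
  have vT: "v 0 \<le> v t" if "0 \<le> t" "t \<le> T" for t
    using v[of 0 t] that norm_ge_zero[of "A t - A 0"] by linarith
  have vt: "v t \<le> v T" if "0 \<le> t" "t \<le> T" for t
    using v[of t T] that norm_ge_zero[of "A T - A t"] by linarith
  \<comment> \<open>The summand \<open>1\<close> keeps the divisor positive when \<open>v\<close> is
    constant. Below, the mesh is \<open>d/2\<close> because the meshes of the two partitions add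
    up.\<close>
  define c where "c = v T - v 0 + 1"
  have c: "c > 0" using vT[of T] True by (simp add: c_def)
  obtain d where d: "d > 0" "\<And>x y. x \<in> {0..T} \<Longrightarrow> y \<in> {0..T} \<Longrightarrow> \<bar>x - y\<bar> \<le> d \<Longrightarrow> dist (H x) (H y) < e / c"
    using uniform_mod_continuity[OF H, of "e / c"] \<open>e > 0\<close> c by auto
  show ?thesis
  proof (rule that[of "d/2"])
    fix t n p \<xi> m q \<eta>
    assume t: "t \<in> {0..T}" and P: "tagged_partition t (d/2) n p \<xi>" and Q: "tagged_partition t (d/2) m q \<eta>"
    have "\<bar>rs_sum H A n p \<xi> - rs_sum H A m q \<eta>\<bar> \<le> e / c * (v t - v 0)"
      by (rule rs_sum_diff_le[OF _ P Q]) (use v t d in \<open>auto simp: dist_norm intro!: less_imp_le\<close>)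
    also have "\<dots> \<le> e / c * c"
      using t vt[of t] c \<open>e > 0\<close> by (intro mult_left_mono) (auto simp: c_def)
    finally show "\<bar>rs_sum H A n p \<xi> - rs_sum H A m q \<eta>\<bar> \<le> e" using c by simp
  qed (use d in auto)
next
  case False
  show ?thesis by (rule that[of 1]) (use False in auto)
qed

section \<open>Sums over equidistant grids truncated at the horizon\<close>

text \<open>The grid of \<open>{0..T}\<close> is truncated at \<open>t\<close> rather than rescaled
  to \<open>{0..t}\<close>: the tags can then be taken independent of \<open>t\<close>, and
  \<open>t\<close> enters only through the arguments of \<open>A\<close>. The price is degenerate
  cells at \<open>t\<close>, which \<open>tagged_partition\<close> admits.\<close>

definition grid :: "real \<Rightarrow> nat \<Rightarrow> real \<Rightarrow> nat \<Rightarrow> real" where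
  "grid T n t k = min t (T * real k / real (Suc n))"

definition grid_sum :: "real \<Rightarrow> (real \<Rightarrow> 'c::real_normed_vector) \<Rightarrow> (real \<Rightarrow> 'c \<Rightarrow>\<^sub>L real) \<Rightarrow> nat \<Rightarrow> real \<Rightarrow> real" where
  "grid_sum T H A n t = rs_sum H A (Suc n) (grid T n t) (grid T n t)"

lemma grid_mem: "0 \<le> t \<Longrightarrow> t \<le> T \<Longrightarrow> grid T n t k \<in> {0..t}"
  by (auto simp: grid_def)

lemma grid_le_Suc: "0 \<le> T \<Longrightarrow> grid T n t k \<le> grid T n t (Suc k)"
  unfolding grid_def by (intro min.mono order_refl divide_right_mono mult_left_mono) auto

lemma grid_ends:
  assumes "0 \<le> t" "t \<le> T" shows "grid T n t 0 = 0" "grid T n t (Suc n) = t"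
  using assms by (auto simp: grid_def min_def)

lemma grid_step_le: "0 \<le> T \<Longrightarrow> grid T n t (Suc k) - grid T n t k \<le> T / real (Suc n)"
proof -
  assume "0 \<le> T"
  have "T * real (Suc k) / real (Suc n) = T * real k / real (Suc n) + T / real (Suc n)"
    by (simp add: add_divide_distrib[symmetric] algebra_simps)
  moreover have "0 \<le> T / real (Suc n)" using \<open>0 \<le> T\<close> by simp
  ultimately show ?thesis unfolding grid_def by linarith
qed

lemma tagged_partition_grid:
  assumes "0 \<le> t" "t \<le> T" "T / real (Suc n) < d"
  shows "tagged_partition t d (Suc n) (grid T n t) (grid T n t)"
  using assms grid_step_le[of T n t] grid_le_Suc[of T n t] grid_ends[of t T n]
  unfolding tagged_partition_def by (auto intro: le_less_trans)

lemma eventually_mesh_less: "0 < d \<Longrightarrow> eventually (\<lambda>n. T / real (Suc n) < d) sequentially"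
proof -
  assume "0 < d"
  have "(\<lambda>n. T / real (Suc n)) \<longlonglongrightarrow> 0"
    by (rule LIMSEQ_Suc[OF lim_const_over_n])
  then show ?thesis using \<open>0 < d\<close> by (rule order_tendstoD)
qed

text \<open>The Cauchy property gives a limit along the grids; comparing an arbitrary fine partition
  with ever finer grids shows that the same number is the integral over all tagged partitions. As a
  limit of one fixed sequence of sums, the integral inherits their measurability and, by uniformity,
  their continuity in \<open>t\<close>.\<close>

lemma grid_sum_converges:
  fixes H :: "real \<Rightarrow> 'c::real_normed_vector"
  assumes v: "\<And>r s. 0 \<le> r \<Longrightarrow> r \<le> s \<Longrightarrow> s \<le> T \<Longrightarrow> norm (A s - A r) \<le> v s - v r"
    and H: "continuous_on {0..T} H"
  shows "uniform_limit {0..T} (grid_sum T H A) (\<lambda>t. lim (\<lambda>n. grid_sum T H A n t)) sequentially"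
    and "\<And>t. t \<in> {0..T} \<Longrightarrow> has_rs_integral H A 0 t (lim (\<lambda>n. grid_sum T H A n t))"
proof -
  have "uniformly_Cauchy_on {0..T} (grid_sum T H A)"
    unfolding uniformly_Cauchy_on_def
  proof (intro allI impI)
    fix e :: real assume "e > 0"
    then obtain d where d: "d > 0"
      "\<And>t n p \<xi> m q \<eta>. t \<in> {0..T} \<Longrightarrow> tagged_partition t d n p \<xi> \<Longrightarrow> tagged_partition t d m q \<eta> \<Longrightarrow>
       \<bar>rs_sum H A n p \<xi> - rs_sum H A m q \<eta>\<bar> \<le> e / 2"
      using rs_sum_uniformly_Cauchy[of T A v H "e/2"] v H by auto
    obtain N where N: "\<And>n. n \<ge> N \<Longrightarrow> T / real (Suc n) < d"
      using eventually_mesh_less[OF d(1)] unfolding eventually_sequentially by blast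
    have "dist (grid_sum T H A m t) (grid_sum T H A n t) < e"
      if "t \<in> {0..T}" "m \<ge> N" "n \<ge> N" for t m n
    proof -
      have "dist (grid_sum T H A m t) (grid_sum T H A n t) \<le> e / 2"
        unfolding dist_real_def grid_sum_def
        by (rule d(2)[OF that(1)]; rule tagged_partition_grid) (use that N in auto)
      then show ?thesis using \<open>e > 0\<close> by simp
    qed
    then show "\<exists>N. \<forall>t\<in>{0..T}. \<forall>m\<ge>N. \<forall>n\<ge>N. dist (grid_sum T H A m t) (grid_sum T H A n t) < e"
      by blast
  qed
  then show ul: "uniform_limit {0..T} (grid_sum T H A) (\<lambda>t. lim (\<lambda>n. grid_sum T H A n t)) sequentially"
    using Cauchy_uniformly_convergent uniformly_convergent_uniform_limit_iff by blast
  fix t assume t: "t \<in> {0..T}"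
  let ?I = "lim (\<lambda>n. grid_sum T H A n t)"
  have lim: "(\<lambda>n. grid_sum T H A n t) \<longlonglongrightarrow> ?I"
    using tendsto_uniform_limitI[OF ul t] .
  show "has_rs_integral H A 0 t ?I"
    unfolding has_rs_integral_iff
  proof (intro allI impI)
    fix e :: real assume "e > 0"
    then obtain d where d: "d > 0"
      "\<And>t n p \<xi> m q \<eta>. t \<in> {0..T} \<Longrightarrow> tagged_partition t d n p \<xi> \<Longrightarrow> tagged_partition t d m q \<eta> \<Longrightarrow>
       \<bar>rs_sum H A n p \<xi> - rs_sum H A m q \<eta>\<bar> \<le> e / 2"
      using rs_sum_uniformly_Cauchy[of T A v H "e/2"] v H by auto
    have "\<bar>rs_sum H A n p \<xi> - ?I\<bar> < e" if P: "tagged_partition t d n p \<xi>" for n p \<xi>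
    proof -
      have "\<bar>rs_sum H A n p \<xi> - grid_sum T H A m t\<bar> \<le> e / 2" if "T / real (Suc m) < d" for m
        unfolding grid_sum_def by (rule d(2)[OF t P tagged_partition_grid]) (use t that in auto)
      then have "eventually (\<lambda>m. \<bar>rs_sum H A n p \<xi> - grid_sum T H A m t\<bar> \<le> e / 2) sequentially"
        using eventually_mesh_less[OF d(1)] by (rule eventually_mono[rotated])
      then have "\<bar>rs_sum H A n p \<xi> - ?I\<bar> \<le> e / 2"
        by (intro tendsto_upperbound[OF tendsto_rabs[OF tendsto_diff[OF tendsto_const lim]]]) simp_all
      then show ?thesis using \<open>e > 0\<close> by simp
    qed
    then show "\<exists>\<delta>>0. \<forall>n p \<xi>. tagged_partition t \<delta> n p \<xi> \<longrightarrow> \<bar>rs_sum H A n p \<xi> - ?I\<bar> < e"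
      using d(1) by blast
  qed
qed

text \<open>Moving the tag from the clamped to the unclamped grid point only affects vanishing terms.\<close>

lemma grid_sum_eq:
  assumes "0 \<le> t" "t \<le> T"
  shows "grid_sum T H A n t =
    (\<Sum>k<Suc n. blinfun_apply (A (grid T n t (Suc k)) - A (grid T n t k)) (H (grid T n T k)))"
  unfolding grid_sum_def rs_sum_def
proof (intro sum.cong refl)
  fix k assume k: "k \<in> {..<Suc n}"
  have le: "T * real k / real (Suc n) \<le> T"
    using k assms by (auto simp: divide_simps intro!: mult_left_mono)
  show "blinfun_apply (A (grid T n t (Suc k)) - A (grid T n t k)) (H (grid T n t k)) =
    blinfun_apply (A (grid T n t (Suc k)) - A (grid T n t k)) (H (grid T n T k))"
  proof (cases "t \<le> T * real k / real (Suc n)")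
    case True
    moreover have "T * real k / real (Suc n) \<le> T * real (Suc k) / real (Suc n)"
      using assms by (intro divide_right_mono mult_left_mono) auto
    ultimately have "grid T n t (Suc k) = grid T n t k" by (auto simp: grid_def min_def)
    then show ?thesis by simp
  next
    case False
    then show ?thesis using le by (simp add: grid_def min_def)
  qed
qed

text \<open>The path \<open>A\<close> may jump in norm; only its pairings with values of
  \<open>H\<close> are continuous. This suffices because, with tags independent of \<open>t\<close>,
  a grid sum is a finite combination of such pairings at times that move continuously with
  \<open>t\<close>.\<close>

lemma continuous_on_rs_limit:
  fixes H :: "real \<Rightarrow> 'c::real_normed_vector" and A :: "real \<Rightarrow> 'c \<Rightarrow>\<^sub>L real"
  assumes v: "\<And>r s. 0 \<le> r \<Longrightarrow> r \<le> s \<Longrightarrow> s \<le> T \<Longrightarrow> norm (A s - A r) \<le> v s - v r"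
    and H: "continuous_on {0..T} H" and "0 \<le> T"
    and A: "\<And>x. x \<in> {0..T} \<Longrightarrow> continuous_on {0..T} (\<lambda>t. blinfun_apply (A t) (H x))"
  shows "continuous_on {0..T} (\<lambda>t. lim (\<lambda>n. grid_sum T H A n t))"
proof (rule uniform_limit_theorem[OF _ grid_sum_converges(1)[OF v H]])
  have "continuous_on {0..T} (grid_sum T H A n)" for n
  proof -
    have "continuous_on {0..T} (\<lambda>t. A (grid T n t k) (H (grid T n T j)))" for k j
      by (rule continuous_on_compose2[OF A[OF grid_mem[of T T]]])
        (use \<open>0 \<le> T\<close> in \<open>auto simp: grid_def intro!: continuous_intros\<close>)
    then have "continuous_on {0..T} (\<lambda>t. \<Sum>k<Suc n. A (grid T n t (Suc k)) (H (grid T n T k)) - A (grid T n t k) (H (grid T n T k)))"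
      by (intro continuous_on_sum continuous_on_diff)
    then show ?thesis
      by (rule continuous_on_eq) (simp add: grid_sum_eq blinfun.diff_left)
  qed
  then show "\<forall>\<^sub>F n in sequentially. continuous_on {0..T} (grid_sum T H A n)" by simp
qed auto

section \<open>Pathwise limits\<close>

lemma integral_partition:
  fixes f :: "real \<Rightarrow> real"
  assumes "continuous_on {p 0..p n} f" "\<forall>k<n. p k \<le> p (Suc k)"
  shows "integral {p 0..p n} f = (\<Sum>k<n. integral {p k..p (Suc k)} f)"
  using assms
proof (induction n)
  case (Suc n)
  have le: "p 0 \<le> p n" "p n \<le> p (Suc n)"
    using Suc.prems(2) by (auto intro: partition_mono[of "Suc n"])
  have "integral {p 0..p (Suc n)} f = integral {p 0..p n} f + integral {p n..p (Suc n)} f"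
    using Suc.prems(1) le
    by (intro Henstock_Kurzweil_Integration.integral_combine[symmetric] integrable_continuous_interval)
  also have "integral {p 0..p n} f = (\<Sum>k<n. integral {p k..p (Suc k)} f)"
    using Suc.prems le by (intro Suc.IH continuous_on_subset[OF Suc.prems(1)]) auto
  finally show ?case by simp
qed simp

lemma integral_abs_diff_le:
  fixes f g h :: "real \<Rightarrow> real"
  assumes "continuous_on {a..b} f" "continuous_on {a..b} g" "continuous_on {a..b} h"
    and "\<And>s. s \<in> {a..b} \<Longrightarrow> \<bar>f s - g s\<bar> \<le> h s"
  shows "\<bar>integral {a..b} f - integral {a..b} g\<bar> \<le> integral {a..b} h"
proof -
  have "\<bar>integral {a..b} (\<lambda>s. f s - g s)\<bar> \<le> integral {a..b} h"
    using assms integral_norm_bound_integral[of "\<lambda>s. f s - g s" "{a..b}" h]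
    by (auto intro!: integrable_continuous_interval continuous_intros)
  then show ?thesis
    using assms by (subst (asm) integral_diff) (auto intro!: integrable_continuous_interval)
qed

lemma integral_initial_mono:
  fixes f :: "real \<Rightarrow> real"
  assumes "continuous_on {0..T} f" "\<And>s. s \<in> {0..T} \<Longrightarrow> 0 \<le> f s" "t \<in> {0..T}"
  shows "integral {0..t} f \<le> integral {0..T} f"
  using assms
  by (intro integral_subset_le integrable_continuous_interval continuous_on_subset[OF assms(1)]) auto

text \<open>As in the Banach-Steinhaus theorem, the bound \<open>K\<close> makes the functionals
  that send \<phi> to the integral of \<open>Q k s \<phi>\<close> equicontinuous, so convergence on
  \<open>D\<close> passes to its closure.\<close>

lemma blinfun_integral_closure_tendsto:
  fixes Q :: "nat \<Rightarrow> real \<Rightarrow> 'c::real_normed_vector \<Rightarrow>\<^sub>L real" and L :: "'c \<Rightarrow>\<^sub>L real"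
  assumes Qc: "\<And>k. continuous_on {0..T} (Q k)"
    and Qb: "\<And>k. integral {0..T} (\<lambda>s. norm (Q k s)) \<le> K"
    and lim: "\<And>d. d \<in> D \<Longrightarrow> (\<lambda>k. integral {0..t} (\<lambda>s. Q k s d)) \<longlonglongrightarrow> L d"
    and \<phi>: "\<phi> \<in> closure D" and t: "t \<in> {0..T}"
  shows "(\<lambda>k. integral {0..t} (\<lambda>s. Q k s \<phi>)) \<longlonglongrightarrow> L \<phi>"
proof (rule LIMSEQ_I)
  fix e :: real assume "e > 0"
  have Qc': "continuous_on {0..t} (Q k)" for k
    by (rule continuous_on_subset[OF Qc]) (use t in auto)
  have nQ: "continuous_on {0..T} (\<lambda>s. norm (Q k s))" for k by (intro continuous_on_norm Qc)
  have nQt: "integral {0..t} (\<lambda>s. norm (Q k s)) \<le> K" for k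
    by (rule order_trans[OF integral_initial_mono[OF nQ] Qb]) (use t in simp_all)
  have K: "K \<ge> 0"
    by (intro order_trans[OF _ Qb[of 0]] integral_nonneg integrable_continuous_interval continuous_on_norm Qc) simp
  \<comment> \<open>\<open>K\<close> and \<open>norm L\<close> weigh the errors of replacing \<phi>
    by \<open>d\<close> under the integral and in the limit; the summand \<open>1\<close> keeps the
    divisor positive.\<close>
  define c where "c = e / (2 * (K + norm L + 1))"
  have c: "c > 0" using \<open>e > 0\<close> K unfolding c_def by (auto intro!: divide_pos_pos add_nonneg_pos add_nonneg_nonneg)
  obtain d where d: "d \<in> D" "norm (\<phi> - d) < c"
    using \<phi> c unfolding closure_approachable by (metis dist_commute dist_norm)
  obtain N where N: "\<And>k. k \<ge> N \<Longrightarrow> norm (integral {0..t} (\<lambda>s. Q k s d) - L d) < e / 2"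
    using LIMSEQ_D[OF lim[OF d(1)], of "e/2"] \<open>e > 0\<close> by auto
  have "norm (integral {0..t} (\<lambda>s. Q k s \<phi>) - L \<phi>) < e" if "k \<ge> N" for k
  proof -
    have "\<bar>integral {0..t} (\<lambda>s. Q k s \<phi>) - integral {0..t} (\<lambda>s. Q k s d)\<bar>
      \<le> integral {0..t} (\<lambda>s. norm (Q k s) * norm (\<phi> - d))"
      using norm_blinfun[of "Q k _" "\<phi> - d"]
      by (intro integral_abs_diff_le continuous_intros Qc') (simp add: blinfun.diff_right[symmetric])
    also have "\<dots> = integral {0..t} (\<lambda>s. norm (Q k s)) * norm (\<phi> - d)" by simp
    also have "\<dots> \<le> K * norm (\<phi> - d)"
      by (intro mult_right_mono nQt) simp
    finally have 1: "\<bar>integral {0..t} (\<lambda>s. Q k s \<phi>) - integral {0..t} (\<lambda>s. Q k s d)\<bar> \<le> K * norm (\<phi> - d)" .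
    have 2: "\<bar>L d - L \<phi>\<bar> \<le> norm L * norm (\<phi> - d)"
      using norm_blinfun[of L "d - \<phi>"] by (simp add: blinfun.diff_right norm_minus_commute)
    have "(K + norm L) * norm (\<phi> - d) \<le> (K + norm L + 1) * c"
      using d(2) K by (intro mult_mono) auto
    also have "\<dots> = e / 2" unfolding c_def using K by (simp add: field_simps add_nonneg_eq_0_iff)
    finally show ?thesis using 1 2 N[OF that] unfolding real_norm_def distrib_right by linarith
  qed
  then show "\<exists>N. \<forall>k\<ge>N. norm (integral {0..t} (\<lambda>s. Q k s \<phi>) - L \<phi>) < e" by blast
qed

text \<open>A form of Helly's convergence theorem: the integrators \<open>Q k s ds\<close> have
  variation at most \<open>K\<close>, and their primitives converge to \<open>A\<close> when tested
  on values of \<open>H\<close>. The grid is fixed before \<open>k\<close>, since the freezing error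
  is at most \<open>c * K\<close> for every \<open>k\<close> and the grid sum does not involve
  \<open>k\<close>. On a cell with frozen integrand the integral is a difference of two integrals
  from \<open>0\<close>, so \<open>lim\<close> applies and \<open>J\<close> tends to the grid
  sum.\<close>

lemma blinfun_integral_tendsto_rs:
  fixes H :: "real \<Rightarrow> 'c::real_normed_vector" and A :: "real \<Rightarrow> 'c \<Rightarrow>\<^sub>L real"
    and Q :: "nat \<Rightarrow> real \<Rightarrow> 'c \<Rightarrow>\<^sub>L real"
  assumes v: "\<And>r s. 0 \<le> r \<Longrightarrow> r \<le> s \<Longrightarrow> s \<le> T \<Longrightarrow> norm (A s - A r) \<le> v s - v r"
    and H: "continuous_on {0..T} H"
    and Qc: "\<And>k. continuous_on {0..T} (Q k)"
    and Qb: "\<And>k. integral {0..T} (\<lambda>s. norm (Q k s)) \<le> K"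
    and lim: "\<And>x s. x \<in> {0..T} \<Longrightarrow> s \<in> {0..T} \<Longrightarrow>
                (\<lambda>k. integral {0..s} (\<lambda>r. Q k r (H x))) \<longlonglongrightarrow> A s (H x)"
    and t: "t \<in> {0..T}"
  shows "(\<lambda>k. integral {0..t} (\<lambda>s. Q k s (H s))) \<longlonglongrightarrow> lim (\<lambda>n. grid_sum T H A n t)"
    (is "?J \<longlonglongrightarrow> ?I")
proof (rule LIMSEQ_I)
  fix e :: real assume "e > 0"
  have T: "0 \<le> t" "t \<le> T" "0 \<le> T" using t by auto
  have sub: "continuous_on {a..b} f" if "continuous_on {0..T} f" "0 \<le> a" "b \<le> T"
    for a b and f :: "real \<Rightarrow> 'z::topological_space"
    by (rule continuous_on_subset[OF that(1)]) (use that in auto)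
  have nQ: "continuous_on {0..T} (\<lambda>s. norm (Q k s))" for k by (intro continuous_on_norm Qc)
  have nQt: "integral {0..t} (\<lambda>s. norm (Q k s)) \<le> K" for k
    by (rule order_trans[OF integral_initial_mono[OF nQ] Qb]) (use t in simp_all)
  have K: "K \<ge> 0"
    by (intro order_trans[OF _ Qb[of 0]] integral_nonneg integrable_continuous_interval continuous_on_norm Qc) simp
  have cQ: "continuous_on {0..T} (\<lambda>s. Q k s x)" for k x
    by (intro blinfun.continuous_on Qc continuous_on_const)
  define c where "c = e / (3 * (K + 1))"
  have c: "c > 0" "c * K \<le> e / 3" using K \<open>e > 0\<close> by (auto simp: c_def field_simps)
  obtain d where d: "d > 0" "\<And>x y. x \<in> {0..T} \<Longrightarrow> y \<in> {0..T} \<Longrightarrow> \<bar>x - y\<bar> \<le> d \<Longrightarrow> dist (H x) (H y) < c"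
    using uniform_mod_continuity[OF H c(1)] by blast
  have "eventually (\<lambda>n. dist (grid_sum T H A n t) ?I < e / 3) sequentially"
    using tendsto_uniform_limitI[OF grid_sum_converges(1)[OF v H] t] \<open>e > 0\<close>
    by (intro tendstoD) auto
  then have "eventually (\<lambda>n. T / real (Suc n) < d \<and> dist (grid_sum T H A n t) ?I < e / 3) sequentially"
    using eventually_mesh_less[OF d(1), of T] by eventually_elim simp
  then obtain n where n: "T / real (Suc n) < d" "dist (grid_sum T H A n t) ?I < e / 3"
    unfolding eventually_sequentially by blast
  define g where "g = grid T n t"
  have g: "g k \<in> {0..t}" "g k \<in> {0..T}" "g k \<le> g (Suc k)" "g (Suc k) - g k \<le> d" for k
    using grid_mem[OF T(1,2), of n k] grid_le_Suc[OF T(3), of n t k] grid_step_le[OF T(3), of n t k] n(1) T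
    by (auto simp: g_def)
  have g0: "g 0 = 0" "g (Suc n) = t" using grid_ends[OF T(1,2), of n] by (auto simp: g_def)
  define J where "J k = (\<Sum>j<Suc n. integral {g j..g (Suc j)} (\<lambda>s. Q k s (H (g j))))" for k
  have J_eq: "J k = (\<Sum>j<Suc n. integral {0..g (Suc j)} (\<lambda>s. Q k s (H (g j))) - integral {0..g j} (\<lambda>s. Q k s (H (g j))))" for k
    unfolding J_def
  proof (intro sum.cong refl)
    fix j
    have "integral {0..g j} (\<lambda>s. Q k s (H (g j))) + integral {g j..g (Suc j)} (\<lambda>s. Q k s (H (g j)))
      = integral {0..g (Suc j)} (\<lambda>s. Q k s (H (g j)))"
      using g[of j] g[of "Suc j"] 
      by (intro Henstock_Kurzweil_Integration.integral_combine integrable_continuous_interval sub[OF cQ]) simp_all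
    then show "integral {g j..g (Suc j)} (\<lambda>s. Q k s (H (g j))) =
      integral {0..g (Suc j)} (\<lambda>s. Q k s (H (g j))) - integral {0..g j} (\<lambda>s. Q k s (H (g j)))" by simp
  qed
  have "J \<longlonglongrightarrow> (\<Sum>j<Suc n. A (g (Suc j)) (H (g j)) - A (g j) (H (g j)))"
    unfolding J_eq by (intro tendsto_intros lim g)
  also have "(\<Sum>j<Suc n. A (g (Suc j)) (H (g j)) - A (g j) (H (g j))) = grid_sum T H A n t"
    by (simp add: grid_sum_def rs_sum_def g_def blinfun.diff_left)
  finally obtain N where N: "\<And>k. k \<ge> N \<Longrightarrow> norm (J k - grid_sum T H A n t) < e / 3"
    using LIMSEQ_D[of J _ "e/3"] \<open>e > 0\<close> by auto
  have JJ: "\<bar>?J k - J k\<bar> \<le> e / 3" for k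
  proof -
    have cQH: "continuous_on {0..T} (\<lambda>s. Q k s (H s))"
      by (intro blinfun.continuous_on Qc H)
    have cn: "continuous_on {0..T} (\<lambda>s. c * norm (Q k s))"
      by (intro continuous_on_mult_left nQ)
    have "?J k = (\<Sum>j<Suc n. integral {g j..g (Suc j)} (\<lambda>s. Q k s (H s)))"
      using integral_partition[of g "Suc n" "\<lambda>s. Q k s (H s)"] g(3) sub[OF cQH, of 0 t] T
      unfolding g0 by blast
    then have "\<bar>?J k - J k\<bar> = \<bar>\<Sum>j<Suc n. integral {g j..g (Suc j)} (\<lambda>s. Q k s (H s)) - integral {g j..g (Suc j)} (\<lambda>s. Q k s (H (g j)))\<bar>"
      unfolding J_def sum_subtractf by (simp only:)
    also have "\<dots> \<le> (\<Sum>j<Suc n. integral {g j..g (Suc j)} (\<lambda>s. c * norm (Q k s)))"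
    proof (intro order_trans[OF sum_abs] sum_mono integral_abs_diff_le)
      fix j s assume s: "s \<in> {g j..g (Suc j)}"
      have "norm (H s - H (g j)) \<le> c"
        using s g[of j] g[of "Suc j"] d(2)[of s "g j"] by (auto simp: dist_norm)
      then have "norm (Q k s) * norm (H s - H (g j)) \<le> norm (Q k s) * c"
        by (intro mult_left_mono) auto
      then show "\<bar>Q k s (H s) - Q k s (H (g j))\<bar> \<le> c * norm (Q k s)"
        using norm_blinfun[of "Q k s" "H s - H (g j)"] by (simp add: blinfun.diff_right mult.commute)
    qed (use g in \<open>auto intro!: sub[OF cQH] sub[OF cn] sub[OF cQ]\<close>)
    also have "\<dots> = integral {0..t} (\<lambda>s. c * norm (Q k s))"
      using integral_partition[of g "Suc n" "\<lambda>s. c * norm (Q k s)"] g(3) sub[OF cn, of 0 t] T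
      unfolding g0 by (metis order_refl)
    also have "\<dots> = c * integral {0..t} (\<lambda>s. norm (Q k s))" by simp
    also have "\<dots> \<le> c * K"
      using c by (intro mult_left_mono nQt) simp
    finally show ?thesis using c by linarith
  qed
  have "norm (?J k - ?I) < e" if "k \<ge> N" for k
    using N[OF that] JJ[of k] n(2) unfolding dist_real_def real_norm_def by linarith
  then show "\<exists>N. \<forall>k\<ge>N. norm (?J k - ?I) < e" by blast
qed

section \<open>From increments of the functions to tensors of increments\<close>

text \<open>The second point \<open>b\<close> need not lie in \<open>S\<close>: it will be a pair of
  mean value points off the paths. The number \<open>d\<close> is a Lebesgue number for the cover of
  \<open>S\<close> by preimages of balls of radius \<open>e/2\<close>.\<close>

lemma continuous_near_compact:
  fixes f :: "'a::metric_space \<Rightarrow> 'b::metric_space"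
  assumes "compact S" "continuous_on UNIV f" "e > 0"
  obtains d where "d > 0" "\<And>a b. a \<in> S \<Longrightarrow> dist a b < d \<Longrightarrow> dist (f a) (f b) < e"
proof -
  let ?G = "range (\<lambda>y. f -` ball y (e/2))"
  have "x \<in> f -` ball (f x) (e/2)" for x using assms(3) by simp
  then have "S \<subseteq> \<Union>?G" by blast
  moreover have "open B" if "B \<in> ?G" for B
    using that assms(2) by (auto intro: open_vimage)
  ultimately obtain d where d: "d > 0" "\<And>x. x \<in> S \<Longrightarrow> \<exists>B\<in>?G. ball x d \<subseteq> B"
    using Heine_Borel_lemma[OF assms(1), of ?G] by metis
  show ?thesis
  proof (rule that[OF d(1)])
    fix a b assume "a \<in> S" "dist a b < d"
    then obtain y where y: "ball a d \<subseteq> f -` ball y (e/2)" using d(2) by blast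
    have "a \<in> ball a d" "b \<in> ball a d" using d(1) \<open>dist a b < d\<close> by auto
    then have "f a \<in> ball y (e/2)" "f b \<in> ball y (e/2)" using y by blast+
    then have "dist y (f a) < e/2" "dist y (f b) < e/2" by simp_all
    then show "dist (f a) (f b) < e"
      using dist_triangle3[of "f a" "f b" y] by linarith
  qed
qed

text \<open>This is the scalar mean value theorem along the segment from \<open>x\<close> to
  \<open>y\<close>; of the position of \<open>z\<close> only its distance to \<open>x\<close> is
  recorded, as the freezing estimate uses nothing else.\<close>

lemma increment_mean_value:
  fixes f :: "'b::real_normed_vector \<Rightarrow> real" and f' :: "'b \<Rightarrow> 'b \<Rightarrow>\<^sub>L real"
  assumes "\<And>x. (f has_derivative blinfun_apply (f' x)) (at x)"
  obtains z where "dist x z \<le> dist x y" "f y - f x = f' z (y - x)"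
proof -
  define h where "h a = f (x + a *\<^sub>R (y - x))" for a :: real
  have D: "DERIV h a :> f' (x + a *\<^sub>R (y - x)) (y - x)" for a
  proof -
    have "((\<lambda>a. x + a *\<^sub>R (y - x)) has_derivative (\<lambda>b. b *\<^sub>R (y - x))) (at a)"
      by (auto intro!: derivative_eq_intros)
    from has_derivative_compose[OF this assms] show ?thesis
      unfolding h_def by (rule has_derivative_imp_has_field_derivative) (simp add: blinfun.scaleR_right)
  qed
  obtain a where a: "0 < a" "a < 1" "h 1 - h 0 = (1 - 0) * f' (x + a *\<^sub>R (y - x)) (y - x)"
    using MVT2[of 0 1 h "\<lambda>a. f' (x + a *\<^sub>R (y - x)) (y - x)"] D by auto
  show ?thesis
  proof (rule that[of "x + a *\<^sub>R (y - x)"])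
    show "dist x (x + a *\<^sub>R (y - x)) \<le> dist x y"
      using a mult_right_mono[of a 1 "norm (y - x)"] by (simp add: dist_norm norm_minus_commute)
    show "f y - f x = f' (x + a *\<^sub>R (y - x)) (y - x)"
      using a by (simp add: h_def)
  qed
qed

lemma bounded_linear_chi_subspace:
  assumes "chi_subspace \<iota>"
  shows "bounded_linear (\<lambda>\<phi>. \<iota> \<phi> a b)"
proof -
  obtain K where K: "\<And>\<phi> a b. \<bar>\<iota> \<phi> a b\<bar> \<le> K * norm \<phi> * norm a * norm b"
    using assms unfolding chi_subspace_def by blast
  have "linear (\<lambda>\<phi>. \<iota> \<phi> a b)" using assms unfolding chi_subspace_def by blast
  moreover have "norm (\<iota> \<phi> a b) \<le> norm \<phi> * (K * norm a * norm b)" for \<phi>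
    using K[of \<phi> a b] by (simp add: mult_ac)
  ultimately show ?thesis by (blast intro: bounded_linear.intro bounded_linear_axioms.intro)
qed

lemma chi_tensor_apply:
  "chi_subspace \<iota> \<Longrightarrow> blinfun_apply (chi_tensor \<iota> a b) \<phi> = \<iota> \<phi> a b"
  unfolding chi_tensor_def by (subst bounded_linear_Blinfun_apply) (auto intro: bounded_linear_chi_subspace)

text \<open>The bound comes from the continuity of the injection of \<chi>. It makes tensors of
  increments of continuous paths norm continuous in time, so every pathwise integrand is
  continuous.\<close>

lemma bounded_bilinear_chi_tensor:
  fixes \<iota> :: "'c::banach \<Rightarrow> 'b::banach \<Rightarrow> 'b \<Rightarrow> real"
  assumes "chi_subspace \<iota>"
  shows "bounded_bilinear (chi_tensor \<iota>)"
proof -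
  obtain K where K: "\<And>\<phi> a b. \<bar>\<iota> \<phi> a b\<bar> \<le> K * norm \<phi> * norm a * norm b"
    using assms unfolding chi_subspace_def by blast
  have bb: "bounded_bilinear (\<iota> \<phi>)" for \<phi> using assms unfolding chi_subspace_def by blast
  note app = chi_tensor_apply[OF assms]
  show ?thesis
  proof
    fix a a' b and r :: real
    show "chi_tensor \<iota> (a + a') b = chi_tensor \<iota> a b + chi_tensor \<iota> a' b"
      by (rule blinfun_eqI) (simp add: app blinfun.add_left bounded_bilinear.add_left[OF bb])
    show "chi_tensor \<iota> b (a + a') = chi_tensor \<iota> b a + chi_tensor \<iota> b a'"
      by (rule blinfun_eqI) (simp add: app blinfun.add_left bounded_bilinear.add_right[OF bb])
    show "chi_tensor \<iota> (r *\<^sub>R a) b = r *\<^sub>R chi_tensor \<iota> a b"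
      by (rule blinfun_eqI) (simp add: app blinfun.scaleR_left bounded_bilinear.scaleR_left[OF bb])
    show "chi_tensor \<iota> a (r *\<^sub>R b) = r *\<^sub>R chi_tensor \<iota> a b"
      by (rule blinfun_eqI) (simp add: app blinfun.scaleR_left bounded_bilinear.scaleR_right[OF bb])
  next
    have "norm (chi_tensor \<iota> a b) \<le> norm a * norm b * \<bar>K\<bar>" for a b
    proof (rule norm_blinfun_bound)
      fix \<phi> :: 'c
      have "K * (norm \<phi> * norm a * norm b) \<le> \<bar>K\<bar> * (norm \<phi> * norm a * norm b)"
        by (intro mult_right_mono) auto
      then show "norm (chi_tensor \<iota> a b \<phi>) \<le> norm a * norm b * \<bar>K\<bar> * norm \<phi>"
        using K[of \<phi> a b] by (simp add: app mult_ac)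
    qed simp
    then show "\<exists>K. \<forall>a b. norm (chi_tensor \<iota> a b) \<le> norm a * norm b * K" by blast
  qed
qed

lemma uniformly_small_increments:
  fixes x :: "real \<Rightarrow> 'b::metric_space"
  assumes x: "continuous_on UNIV x" and \<epsilon>: "\<epsilon> \<longlonglongrightarrow> 0" "\<And>k::nat. 0 < \<epsilon> k" and "0 < d"
  shows "eventually (\<lambda>k. \<forall>s\<in>{0..T}. dist (x s) (x (s + \<epsilon> k)) < d) sequentially"
proof -
  \<comment> \<open>The shifted time \<open>s + \<epsilon> k\<close> can leave
    \<open>{0..T}\<close>; a margin of length \<open>1\<close>, together with \<open>min c 1\<close>
    below, contains it.\<close>
  obtain c where c: "c > 0" "\<And>r s. r \<in> {0..T + 1} \<Longrightarrow> s \<in> {0..T + 1} \<Longrightarrow> \<bar>r - s\<bar> \<le> c \<Longrightarrow> dist (x r) (x s) < d"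
    using uniform_mod_continuity[where H = x and T = "T + 1" and e = d] continuous_on_subset[OF x] \<open>0 < d\<close>
    by auto
  have "eventually (\<lambda>k. \<epsilon> k < min c 1) sequentially"
    using c(1) by (intro order_tendstoD[OF \<epsilon>(1)]) auto
  then show ?thesis
    by eventually_elim (use c(2) \<epsilon>(2) in \<open>auto simp: less_imp_le\<close>)
qed

text \<open>Two separate applications of the mean value theorem replace the double integral of the
  usual Taylor expansion of both factors.\<close>

lemma increment_product_diff_le:
  fixes F G :: "'b::banach \<Rightarrow> real" and \<iota> :: "'c::banach \<Rightarrow> 'b \<Rightarrow> 'b \<Rightarrow> real"
  assumes "chi_subspace \<iota>"
    and F: "\<And>a. (F has_derivative blinfun_apply (F' a)) (at a)"
    and G: "\<And>a. (G has_derivative blinfun_apply (G' a)) (at a)"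
    and \<Gamma>: "\<And>a b. \<iota> (\<Gamma> a b) = (\<lambda>u w. F' a u * G' b w)"
    and close: "\<And>z z'. dist a z \<le> dist a a' \<Longrightarrow> dist b z' \<le> dist b b' \<Longrightarrow> dist (\<Gamma> a b) (\<Gamma> z z') \<le> e"
  shows "\<bar>(F a' - F a) * (G b' - G b) - \<iota> (\<Gamma> a b) (a' - a) (b' - b)\<bar>
    \<le> e * norm (chi_tensor \<iota> (a' - a) (b' - b))"
proof -
  obtain z where z: "dist a z \<le> dist a a'" "F a' - F a = F' z (a' - a)"
    using increment_mean_value[OF F] by blast
  obtain z' where z': "dist b z' \<le> dist b b'" "G b' - G b = G' z' (b' - b)"
    using increment_mean_value[OF G] by blast
  note app = chi_tensor_apply[OF assms(1)]
  have "(F a' - F a) * (G b' - G b) - \<iota> (\<Gamma> a b) (a' - a) (b' - b)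
    = chi_tensor \<iota> (a' - a) (b' - b) (\<Gamma> z z' - \<Gamma> a b)"
    by (simp add: z z' app blinfun.diff_right \<Gamma>)
  also have "\<bar>\<dots>\<bar> \<le> norm (chi_tensor \<iota> (a' - a) (b' - b)) * norm (\<Gamma> z z' - \<Gamma> a b)"
    using norm_blinfun[of "chi_tensor \<iota> (a' - a) (b' - b)"] by simp
  also have "\<dots> \<le> norm (chi_tensor \<iota> (a' - a) (b' - b)) * e"
    using close[OF z(1) z'(1)] by (intro mult_left_mono) (auto simp: dist_norm norm_minus_commute)
  finally show ?thesis by (simp add: mult.commute)
qed

text \<open>This is the whole analytic argument for one fixed outcome: \<open>bound\<close> is what
  (H1) supplies, \<open>lim\<close> what (H2) supplies on a countable set, and \<open>v\<close> the
  variation of the path of the \<chi>-covariation. Only null sets and measurability remain after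
  it.\<close>

lemma path_covariation_tendsto:
  fixes F G :: "'b::banach \<Rightarrow> real" and \<iota> :: "'c::banach \<Rightarrow> 'b \<Rightarrow> 'b \<Rightarrow> real"
    and x y :: "real \<Rightarrow> 'b" and A :: "real \<Rightarrow> 'c \<Rightarrow>\<^sub>L real"
  assumes chi: "chi_subspace \<iota>"
    and F: "\<And>a. (F has_derivative blinfun_apply (F' a)) (at a)"
    and G: "\<And>a. (G has_derivative blinfun_apply (G' a)) (at a)"
    and \<Gamma>: "\<And>a b. \<iota> (\<Gamma> a b) = (\<lambda>u w. F' a u * G' b w)"
    and \<Gamma>c: "continuous_on UNIV (\<lambda>(a, b). \<Gamma> a b)"
    and x: "continuous_on UNIV x" and y: "continuous_on UNIV y"
    and \<epsilon>: "\<epsilon> \<longlonglongrightarrow> 0" "\<And>k::nat. 0 < \<epsilon> k"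
    and v: "\<And>r s. 0 \<le> r \<Longrightarrow> r \<le> s \<Longrightarrow> s \<le> T \<Longrightarrow> norm (A s - A r) \<le> v s - v r"
    and bound: "\<And>k. integral {0..T} (\<lambda>s. norm (chi_tensor \<iota> (x (s + \<epsilon> k) - x s) (y (s + \<epsilon> k) - y s)) / \<epsilon> k) \<le> K"
    and D: "\<And>s. s \<in> {0..T} \<Longrightarrow> \<Gamma> (x s) (y s) \<in> closure D"
    and lim: "\<And>d t. d \<in> D \<Longrightarrow> t \<in> {0..T} \<Longrightarrow>
       (\<lambda>k. integral {0..t} (\<lambda>s. \<iota> d (x (s + \<epsilon> k) - x s) (y (s + \<epsilon> k) - y s) / \<epsilon> k)) \<longlonglongrightarrow> A t d"
    and t: "t \<in> {0..T}"
  shows "(\<lambda>k. integral {0..t} (\<lambda>s. (F (x (s + \<epsilon> k)) - F (x s)) * (G (y (s + \<epsilon> k)) - G (y s)) / \<epsilon> k))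
    \<longlonglongrightarrow> lim (\<lambda>n. grid_sum T (\<lambda>s. \<Gamma> (x s) (y s)) A n t)"
proof -
  define H where "H s = \<Gamma> (x s) (y s)" for s
  define Q where "Q k s = chi_tensor \<iota> (x (s + \<epsilon> k) - x s) (y (s + \<epsilon> k) - y s) /\<^sub>R \<epsilon> k" for k s
  note app = chi_tensor_apply[OF chi]
  have xs: "continuous_on S (\<lambda>s. x (s + c))" "continuous_on S x" for S c
    by (rule continuous_on_compose2[OF x] continuous_on_subset[OF x]; auto intro!: continuous_intros)+
  have ys: "continuous_on S (\<lambda>s. y (s + c))" "continuous_on S y" for S c
    by (rule continuous_on_compose2[OF y] continuous_on_subset[OF y]; auto intro!: continuous_intros)+
  have Hc: "continuous_on S H" for S
    unfolding H_def
    using continuous_on_compose2[OF \<Gamma>c continuous_on_Pair[OF xs(2) ys(2)], of S] by simp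
  have Qc: "continuous_on S (Q k)" for S k
    unfolding Q_def
    by (intro continuous_on_scaleR continuous_on_const continuous_on_diff xs ys
          bounded_bilinear.continuous_on[OF bounded_bilinear_chi_tensor[OF chi]])
  have Fc: "continuous_on UNIV F" and Gc: "continuous_on UNIV G"
    using F G by (auto intro!: continuous_at_imp_continuous_on has_derivative_continuous)
  have cov_c: "continuous_on S (\<lambda>s. (F (x (s + \<epsilon> k)) - F (x s)) * (G (y (s + \<epsilon> k)) - G (y s)) / \<epsilon> k)" for S k
    using \<epsilon>(2)[of k]
    by (intro continuous_on_divide continuous_on_mult continuous_on_diff continuous_on_const
          continuous_on_compose2[OF Fc] continuous_on_compose2[OF Gc] xs ys) auto
  have nQ: "norm (Q k s) = norm (chi_tensor \<iota> (x (s + \<epsilon> k) - x s) (y (s + \<epsilon> k) - y s)) / \<epsilon> k" for k s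
    using \<epsilon>(2)[of k] by (simp add: Q_def divide_inverse mult.commute)
  have Qapp: "Q k s \<phi> = \<iota> \<phi> (x (s + \<epsilon> k) - x s) (y (s + \<epsilon> k) - y s) / \<epsilon> k" for k s \<phi>
    by (simp add: Q_def blinfun.scaleR_left app divide_inverse mult.commute)
  have Qb: "integral {0..T} (\<lambda>s. norm (Q k s)) \<le> K" for k
    unfolding nQ by (rule bound)
  have nQc: "continuous_on S (\<lambda>s. norm (Q k s))" for S k by (intro continuous_on_norm Qc)
  have Qbt: "integral {0..t} (\<lambda>s. norm (Q k s)) \<le> K" for k
    by (rule order_trans[OF integral_initial_mono[OF nQc] Qb]) (use t in simp_all)
  have limD: "(\<lambda>k. integral {0..s} (\<lambda>r. Q k r d)) \<longlonglongrightarrow> A s d" if "d \<in> D" "s \<in> {0..T}" for d s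
    unfolding Qapp by (rule lim[OF that])
  have main: "(\<lambda>k. integral {0..t} (\<lambda>s. Q k s (H s))) \<longlonglongrightarrow> lim (\<lambda>n. grid_sum T H A n t)"
  proof (rule blinfun_integral_tendsto_rs[OF v Hc Qc Qb _ t])
    fix r s assume "r \<in> {0..T}" "s \<in> {0..T}"
    then show "(\<lambda>k. integral {0..s} (\<lambda>q. Q k q (H r))) \<longlonglongrightarrow> A s (H r)"
      by (intro blinfun_integral_closure_tendsto[OF Qc Qb limD]) (auto simp: H_def D)
  qed
  let ?C = "\<lambda>k. integral {0..t} (\<lambda>s. (F (x (s + \<epsilon> k)) - F (x s)) * (G (y (s + \<epsilon> k)) - G (y s)) / \<epsilon> k)"
  have "(\<lambda>k. ?C k - integral {0..t} (\<lambda>s. Q k s (H s))) \<longlonglongrightarrow> 0"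
  proof (rule tendstoI)
    fix e :: real assume "e > 0"
    have K: "K \<ge> 0"
      by (intro order_trans[OF _ Qb[of 0]] integral_nonneg integrable_continuous_interval nQc) simp
    define c where "c = e / (K + 1)"
    have c: "c > 0" "c * K < e" using K \<open>e > 0\<close> by (auto simp: c_def field_simps)
    have "compact ((\<lambda>s. (x s, y s)) ` {0..T})"
      by (intro compact_continuous_image continuous_on_Pair xs ys) simp
    then obtain d where d: "d > 0" "\<And>a b. a \<in> (\<lambda>s. (x s, y s)) ` {0..T} \<Longrightarrow> dist a b < d \<Longrightarrow>
        dist ((\<lambda>(a, b). \<Gamma> a b) a) ((\<lambda>(a, b). \<Gamma> a b) b) < c"
      using continuous_near_compact[OF _ \<Gamma>c c(1)] by blast
    have "eventually (\<lambda>k. (\<forall>s\<in>{0..T}. dist (x s) (x (s + \<epsilon> k)) < d / 2) \<and>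
       (\<forall>s\<in>{0..T}. dist (y s) (y (s + \<epsilon> k)) < d / 2)) sequentially"
      using d(1) by (intro eventually_conj uniformly_small_increments x y \<epsilon>) auto
    then show "eventually (\<lambda>k. dist (?C k - integral {0..t} (\<lambda>s. Q k s (H s))) 0 < e) sequentially"
    proof eventually_elim
      case (elim k)
      have "\<bar>?C k - integral {0..t} (\<lambda>s. Q k s (H s))\<bar> \<le> integral {0..t} (\<lambda>s. c * norm (Q k s))"
      proof (rule integral_abs_diff_le)
        fix s assume "s \<in> {0..t}"
        then have s: "s \<in> {0..T}" using t by auto
        have "\<bar>(F (x (s + \<epsilon> k)) - F (x s)) * (G (y (s + \<epsilon> k)) - G (y s))
            - \<iota> (\<Gamma> (x s) (y s)) (x (s + \<epsilon> k) - x s) (y (s + \<epsilon> k) - y s)\<bar>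
          \<le> c * norm (chi_tensor \<iota> (x (s + \<epsilon> k) - x s) (y (s + \<epsilon> k) - y s))"
        proof (rule increment_product_diff_le[OF chi F G \<Gamma>])
          fix z z' assume z: "dist (x s) z \<le> dist (x s) (x (s + \<epsilon> k))" "dist (y s) z' \<le> dist (y s) (y (s + \<epsilon> k))"
          have "dist (x s, y s) (z, z') \<le> dist (x s) z + dist (y s) z'"
            by (simp add: dist_Pair_Pair real_sqrt_sum_squares_triangle_ineq sqrt_sum_squares_le_sum)
          also have "\<dots> < d / 2 + d / 2"
            using bspec[OF conjunct1[OF elim] s] bspec[OF conjunct2[OF elim] s] z by linarith
          finally show "dist (\<Gamma> (x s) (y s)) (\<Gamma> z z') \<le> c"
            using d(2)[of "(x s, y s)" "(z, z')"] s by auto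
        qed
        then have "\<bar>(F (x (s + \<epsilon> k)) - F (x s)) * (G (y (s + \<epsilon> k)) - G (y s))
            - \<iota> (\<Gamma> (x s) (y s)) (x (s + \<epsilon> k) - x s) (y (s + \<epsilon> k) - y s)\<bar> / \<epsilon> k
          \<le> c * norm (chi_tensor \<iota> (x (s + \<epsilon> k) - x s) (y (s + \<epsilon> k) - y s)) / \<epsilon> k"
          using \<epsilon>(2)[of k] by (intro divide_right_mono) auto
        then show "\<bar>(F (x (s + \<epsilon> k)) - F (x s)) * (G (y (s + \<epsilon> k)) - G (y s)) / \<epsilon> k - Q k s (H s)\<bar>
          \<le> c * norm (Q k s)"
          using \<epsilon>(2)[of k] by (simp add: Qapp nQ H_def diff_divide_distrib[symmetric])
      qed (intro cov_c blinfun.continuous_on Qc Hc continuous_on_mult_left nQc)+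
      also have "\<dots> = c * integral {0..t} (\<lambda>s. norm (Q k s))" by simp
      also have "\<dots> \<le> c * K" using c by (intro mult_left_mono Qbt) simp
      finally show ?case using c by (simp add: dist_real_def)
    qed
  qed
  from tendsto_add[OF this main] show ?thesis unfolding H_def by simp
qed

section \<open>Measurability and convergence in probability\<close>

text \<open>\<open>X\<close> is approximated by the first point of an enumeration of
  \<open>D\<close> within distance \<open>1 / real (Suc m)\<close>. This choice takes countably many
  values, so inserting it into \<open>g\<close> is measurable, and continuity of
  \<open>g \<omega>\<close> gives the limit. Separability is asked of the argument space
  alone.\<close>

lemma borel_measurable_caratheodory:
  fixes g :: "'w \<Rightarrow> 'b::metric_space \<Rightarrow> real"
  assumes D: "countable D" "closure D = (UNIV :: 'b set)"
    and X: "X \<in> borel_measurable M"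
    and meas: "\<And>x. (\<lambda>\<omega>. g \<omega> x) \<in> borel_measurable M"
    and cont: "\<And>\<omega>. \<omega> \<in> space M \<Longrightarrow> continuous_on UNIV (g \<omega>)"
  shows "(\<lambda>\<omega>. g \<omega> (X \<omega>)) \<in> borel_measurable M"
proof -
  have "D \<noteq> {}" using D(2) by auto
  then have rng: "range (from_nat_into D) = D" using D(1) by (rule range_from_nat_into)
  define d where "d = from_nat_into D"
  define idx where "idx m \<omega> = (LEAST k. dist (X \<omega>) (d k) < 1 / real (Suc m))" for m \<omega>
  have idx: "dist (X \<omega>) (d (idx m \<omega>)) < 1 / real (Suc m)" for m \<omega>
  proof -
    have "X \<omega> \<in> closure D" using D(2) by simp
    then obtain z where "z \<in> D" "dist z (X \<omega>) < 1 / real (Suc m)"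
      unfolding closure_approachable by (metis divide_pos_pos of_nat_0_less_iff zero_less_Suc zero_less_one)
    then obtain k where "dist (X \<omega>) (d k) < 1 / real (Suc m)"
      using rng unfolding d_def by (metis dist_commute imageE)
    then show ?thesis unfolding idx_def by (rule LeastI)
  qed
  have dist_meas: "(\<lambda>\<omega>. dist (X \<omega>) z) \<in> borel_measurable M" for z
    by (rule measurable_compose[OF X borel_measurable_continuous_onI]) (intro continuous_intros)
  have [measurable]: "idx m \<in> measurable M (count_space UNIV)" for m
    unfolding idx_def using dist_meas by measurable
  show ?thesis
  proof (rule borel_measurable_LIMSEQ_real)
    show "(\<lambda>\<omega>. g \<omega> (d (idx m \<omega>))) \<in> borel_measurable M" for m
      by (rule measurable_compose_countable[OF meas]) measurable
  next
    fix \<omega> assume "\<omega> \<in> space M"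
    have "(\<lambda>m. dist (d (idx m \<omega>)) (X \<omega>)) \<longlonglongrightarrow> 0"
      by (rule real_tendsto_sandwich[OF _ _ tendsto_const LIMSEQ_Suc[OF lim_const_over_n[of 1]]])
         (use idx in \<open>auto intro!: always_eventually less_imp_le simp: dist_commute\<close>)
    then have "(\<lambda>m. d (idx m \<omega>)) \<longlonglongrightarrow> X \<omega>" by (rule tendsto_dist_iff[THEN iffD2])
    moreover have "isCont (g \<omega>) (X \<omega>)"
      using cont[OF \<open>\<omega> \<in> space M\<close>] by (simp add: continuous_on_eq_continuous_at)
    ultimately show "(\<lambda>m. g \<omega> (d (idx m \<omega>))) \<longlonglongrightarrow> g \<omega> (X \<omega>)"
      by (rule isCont_tendsto_compose[rotated])
  qed
qed

text \<open>Continuity in time and measurability at each fixed time give joint measurability, by the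
  preceding lemma with the rationals as dense set and time as argument; integrating out time
  preserves measurability.\<close>

lemma borel_measurable_integral_continuous:
  fixes f :: "real \<Rightarrow> 'w \<Rightarrow> real"
  assumes meas: "\<And>s. f s \<in> borel_measurable M"
    and cont: "\<And>\<omega>. \<omega> \<in> space M \<Longrightarrow> continuous_on UNIV (\<lambda>s. f s \<omega>)"
  shows "(\<lambda>\<omega>. integral {a..b} (\<lambda>s. f s \<omega>)) \<in> borel_measurable M"
proof -
  have "(\<lambda>p. f (snd p) (fst p)) \<in> borel_measurable (M \<Otimes>\<^sub>M lborel)"
  proof (rule borel_measurable_caratheodory[where g = "\<lambda>p z. f z (fst p)" and X = snd, OF countable_rat Rats_closure_real])
    show "(\<lambda>p. f x (fst p)) \<in> borel_measurable (M \<Otimes>\<^sub>M lborel)" for x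
      by (rule measurable_compose[OF measurable_fst meas])
  qed (use cont in \<open>auto simp: space_pair_measure\<close>)
  then have [measurable]: "(\<lambda>(\<omega>, s). f s \<omega>) \<in> borel_measurable (M \<Otimes>\<^sub>M lborel)"
    by (simp add: case_prod_unfold)
  have "(\<lambda>\<omega>. \<integral>s. indicator {a..b} s *\<^sub>R f s \<omega> \<partial>lborel) \<in> borel_measurable M"
    by measurable
  moreover have eq: "(\<integral>s. indicator {a..b} s *\<^sub>R f s \<omega> \<partial>lborel) = integral {a..b} (\<lambda>s. f s \<omega>)"
    if "\<omega> \<in> space M" for \<omega>
    using set_borel_integral_eq_integral(2)[OF borel_integrable_atLeastAtMost', of a b "\<lambda>s. f s \<omega>"]
      continuous_on_subset[OF cont[OF that]]
    unfolding set_lebesgue_integral_def by auto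
  ultimately show ?thesis by (simp only: measurable_cong[OF eq])
qed

text \<open>A bridge from the nonnegative Lebesgue integral of (H1) to the gauge integral of the
  pathwise estimates.\<close>

lemma integral_le_of_nn_integral_le:
  fixes f :: "real \<Rightarrow> real"
  assumes "continuous_on {a..b} f" "\<And>s. s \<in> {a..b} \<Longrightarrow> 0 \<le> f s"
    and "(\<integral>\<^sup>+ s. indicator {a..b} s * ennreal (f s) \<partial>lborel) \<le> ennreal K" "0 \<le> K"
  shows "integral {a..b} f \<le> K"
proof -
  have "(\<integral>\<^sup>+ s. indicator {a..b} s * ennreal (f s) \<partial>lborel)
    = (\<integral>\<^sup>+ s. ennreal (indicator {a..b} s * f s) \<partial>lborel)"
    by (intro nn_integral_cong) (auto split: split_indicator)
  also have "\<dots> = ennreal (integral {a..b} f)"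
    by (rule nn_integral_has_integral_lebesgue)
      (use assms in \<open>auto intro!: integrable_integral integrable_continuous_interval\<close>)
  finally show ?thesis using assms(3,4) by simp
qed

text \<open>The subsequence criterion: a sequence of steps along which the probability bound fails
  would have a subsequence with almost sure convergence, and dominated convergence for the
  indicators of the exceptional events would restore the bound along it.\<close>

lemma conv_in_prob_at_rightI:
  fixes Z :: "real \<Rightarrow> 'w \<Rightarrow> real"
  assumes "prob_space M" and Z: "\<And>e. Z e \<in> borel_measurable M" and L: "L \<in> borel_measurable M"
    and sub: "\<And>\<epsilon>. (\<And>n::nat. 0 < \<epsilon> n) \<Longrightarrow> \<epsilon> \<longlonglongrightarrow> 0 \<Longrightarrow>
      \<exists>r::nat \<Rightarrow> nat. strict_mono r \<and> (AE \<omega> in M. (\<lambda>k. Z (\<epsilon> (r k)) \<omega>) \<longlonglongrightarrow> L \<omega>)"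
  shows "conv_in_prob M Z L (at_right 0)"
  unfolding conv_in_prob_def
proof (intro allI impI)
  interpret prob_space M by fact
  note [measurable] = Z L
  fix \<delta> \<eta> :: real assume pos: "\<delta> > 0" "\<eta> > 0"
  define P where "P e \<longleftrightarrow> (\<exists>A\<in>sets M. {\<omega> \<in> space M. \<delta> \<le> \<bar>Z e \<omega> - L \<omega>\<bar>} \<subseteq> A \<and> measure M A < \<eta>)" for e
  have "eventually P (at_right 0)"
  proof (rule sequentially_imp_eventually_at_right[of 0 1])
    fix f :: "nat \<Rightarrow> real" assume f: "\<And>n. 0 < f n" "f \<longlonglongrightarrow> 0"
    show "eventually (\<lambda>n. P (f n)) sequentially"
    proof (rule ccontr)
      assume "\<not> ?thesis"
      then obtain r :: "nat \<Rightarrow> nat" where r: "strict_mono r" "\<And>n. \<not> P (f (r n))"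
        using not_eventually_sequentiallyD[of "\<lambda>n. P (f n)"] by auto
      have "(\<lambda>n. f (r n)) \<longlonglongrightarrow> 0"
        using LIMSEQ_subseq_LIMSEQ[OF f(2) r(1)] by (simp only: o_def)
      from sub[OF f(1) this]
      obtain r' where r': "AE \<omega> in M. (\<lambda>k. Z (f (r (r' k))) \<omega>) \<longlonglongrightarrow> L \<omega>" by blast
      define E where "E k = {\<omega> \<in> space M. \<delta> \<le> \<bar>Z (f (r (r' k))) \<omega> - L \<omega>\<bar>}" for k
      have [measurable]: "E k \<in> sets M" for k
        unfolding E_def by measurable
      have "(\<lambda>k. \<integral>\<omega>. indicat_real (E k) \<omega> \<partial>M) \<longlonglongrightarrow> (\<integral>\<omega>. 0 \<partial>M)"
      proof (rule integral_dominated_convergence[where w = "\<lambda>_. 1"])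
        show "AE \<omega> in M. (\<lambda>k. indicat_real (E k) \<omega>) \<longlonglongrightarrow> 0"
          using r'
        proof eventually_elim
          case (elim \<omega>)
          have "eventually (\<lambda>k. dist (Z (f (r (r' k))) \<omega>) (L \<omega>) < \<delta>) sequentially"
            using tendstoD[OF elim pos(1)] .
          then have "eventually (\<lambda>k. indicat_real (E k) \<omega> = 0) sequentially"
            by eventually_elim (auto simp: E_def dist_real_def indicator_def)
          then show ?case by (rule tendsto_eventually)
        qed
      qed (auto simp: indicator_def)
      then have "(\<lambda>k. measure M (E k)) \<longlonglongrightarrow> 0" by simp
      then have "eventually (\<lambda>k. measure M (E k) < \<eta>) sequentially"
        using pos(2) by (rule order_tendstoD)
      then obtain k where "measure M (E k) < \<eta>" unfolding eventually_sequentially by blast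
      then have "P (f (r (r' k)))" unfolding P_def by (intro bexI[of _ "E k"]) (auto simp: E_def[of k])
      then show False using r(2) by blast
    qed
  qed simp
  then show "eventually (\<lambda>e. \<exists>A\<in>sets M. {\<omega> \<in> space M. \<delta> \<le> \<bar>Z e \<omega> - L \<omega>\<bar>} \<subseteq> A \<and> measure M A < \<eta>) (at_right 0)"
    unfolding P_def .
qed

text \<open>A diagonal choice combined with Borel-Cantelli: stage \<open>k\<close> controls only the
  processes with index \<open>m \<le> k\<close>, with tolerance \<open>1 / real (Suc k)\<close>, so
  each process is controlled from stage \<open>m\<close> on and one subsequence serves all of
  them.\<close>

lemma unif_conv_in_prob_AE_subsequence:
  fixes Z :: "nat \<Rightarrow> real \<Rightarrow> real \<Rightarrow> 'w \<Rightarrow> real"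
  assumes "prob_space M" and conv: "\<And>m. unif_conv_in_prob M T (Z m) (L m) (at_right 0)"
    and \<epsilon>: "\<And>n::nat. 0 < \<epsilon> n" "\<epsilon> \<longlonglongrightarrow> 0"
  obtains r where "strict_mono (r::nat \<Rightarrow> nat)"
    "AE \<omega> in M. \<forall>m. \<forall>t\<in>{0..T}. (\<lambda>k. Z m (\<epsilon> (r k)) t \<omega>) \<longlonglongrightarrow> L m t \<omega>"
proof -
  interpret prob_space M by fact
  define bad where "bad m k e = {\<omega>\<in>space M. \<exists>t\<in>{0..T}. 1 / real (Suc k) \<le> \<bar>Z m e t \<omega> - L m t \<omega>\<bar>}" for m k e
  \<comment> \<open>The divisor is the number of indices \<open>m \<le> k\<close>, so the union over
    these indices has measure at most \<open>(1/2) ^ k\<close>, which is summable.\<close>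
  let ?\<eta> = "\<lambda>k. (1/2) ^ k / real (Suc k)"
  define P where "P k e \<longleftrightarrow> (\<forall>m\<in>{..k}. \<exists>A\<in>sets M. bad m k e \<subseteq> A \<and> measure M A < ?\<eta> k)" for k e
  have flim: "filterlim \<epsilon> (at_right 0) sequentially"
  proof -
    have "\<epsilon> n \<noteq> 0" for n using \<epsilon>(1)[of n] by simp
    then show ?thesis unfolding filterlim_at using \<epsilon> by simp
  qed
  have "eventually (P k) (at_right 0)" for k
  proof -
    have "eventually (\<lambda>e. \<exists>A\<in>sets M. bad m k e \<subseteq> A \<and> measure M A < ?\<eta> k) (at_right 0)" for m
      using conv[of m] unfolding unif_conv_in_prob_def bad_def by simp
    then show ?thesis unfolding P_def by (intro eventually_ball_finite) auto
  qed
  then have "eventually (\<lambda>n. P k (\<epsilon> n)) sequentially" for k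
    by (rule eventually_compose_filterlim[OF _ flim])
  then have "\<forall>k. \<exists>N. \<forall>n\<ge>N. P k (\<epsilon> n)"
    unfolding eventually_sequentially by blast
  from choice[OF this] obtain N where N: "\<And>k n. n \<ge> N k \<Longrightarrow> P k (\<epsilon> n)"
    by blast
  \<comment> \<open>The sum dominates \<open>N k\<close>, and the summand \<open>k\<close> makes
    \<open>r\<close> strictly increasing.\<close>
  define r where "r k = k + (\<Sum>i\<le>k. N i)" for k
  have r: "strict_mono r" unfolding r_def by (rule strict_mono_Suc_iff[THEN iffD2]) simp
  have "N k \<le> r k" for k
    unfolding r_def using member_le_sum[of k "{..k}" N] by simp
  then have "P k (\<epsilon> (r k))" for k by (rule N)
  \<comment> \<open>The sets \<open>bad\<close> involve uncountably many times and are not known to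
    be measurable, so Borel-Cantelli is applied to measurable covers.\<close>
  then have "\<forall>k m. \<exists>A. m \<le> k \<longrightarrow> A \<in> sets M \<and> bad m k (\<epsilon> (r k)) \<subseteq> A \<and> measure M A < ?\<eta> k"
    unfolding P_def by (meson atMost_iff)
  then obtain A where A0: "\<forall>k m. m \<le> k \<longrightarrow> A k m \<in> sets M \<and> bad m k (\<epsilon> (r k)) \<subseteq> A k m \<and> measure M (A k m) < ?\<eta> k"
    unfolding choice_iff by blast
  then have A: "\<And>m k. m \<le> k \<Longrightarrow> A k m \<in> sets M"
    "\<And>m k. m \<le> k \<Longrightarrow> bad m k (\<epsilon> (r k)) \<subseteq> A k m" "\<And>m k. m \<le> k \<Longrightarrow> measure M (A k m) < ?\<eta> k"
    by blast+
  define B where "B k = (\<Union>m\<le>k. A k m)" for k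
  have B: "B k \<in> sets M" for k unfolding B_def using A(1) by auto
  have "measure M (B k) \<le> (1/2) ^ k" for k
  proof -
    have "measure M (B k) \<le> (\<Sum>m\<le>k. measure M (A k m))"
      unfolding B_def using A(1) by (intro measure_UNION_le) auto
    also have "\<dots> \<le> (\<Sum>m\<le>k. ?\<eta> k)" using A(3) by (intro sum_mono less_imp_le) auto
    also have "\<dots> = (1/2) ^ k" by simp
    finally show ?thesis .
  qed
  then have "summable (\<lambda>k. measure M (B k))"
    by (intro summable_comparison_test'[OF summable_geometric[of "1/2::real"]]) auto
  then have "AE \<omega> in M. eventually (\<lambda>k. \<omega> \<in> space M - B k) sequentially"
    using B by (intro borel_cantelli_AE1) (auto simp: emeasure_eq_measure)
  then have "AE \<omega> in M. \<forall>m. \<forall>t\<in>{0..T}. (\<lambda>k. Z m (\<epsilon> (r k)) t \<omega>) \<longlonglongrightarrow> L m t \<omega>"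
  proof eventually_elim
    case (elim \<omega>)
    show ?case
    proof (intro allI ballI)
      fix m t assume t: "t \<in> {0..T}"
      have "(\<lambda>k. \<bar>Z m (\<epsilon> (r k)) t \<omega> - L m t \<omega>\<bar>) \<longlonglongrightarrow> 0"
      proof (rule real_tendsto_sandwich[OF _ _ tendsto_const LIMSEQ_Suc[OF lim_const_over_n[of 1]]])
        show "eventually (\<lambda>k. \<bar>Z m (\<epsilon> (r k)) t \<omega> - L m t \<omega>\<bar> \<le> 1 / real (Suc k)) sequentially"
          using elim eventually_ge_at_top[of m]
        proof eventually_elim
          case (elim k)
          then have "\<omega> \<notin> bad m k (\<epsilon> (r k))" using A(2)[of m k] by (auto simp: B_def)
          then show ?case using t elim by (auto simp: bad_def not_le intro: less_imp_le)
        qed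
      qed simp
      then show "(\<lambda>k. Z m (\<epsilon> (r k)) t \<omega>) \<longlonglongrightarrow> L m t \<omega>"
        by (simp add: tendsto_rabs_zero_iff LIM_zero_cancel)
    qed
  qed
  then show ?thesis using that r by blast
qed

section \<open>Regularity of the \<chi>-covariation path\<close>

text \<open>Every \<open>t < T\<close> is a limit of rational times from the right, along which both
  functions converge to their values at \<open>t\<close>. The endpoint \<open>T\<close> has to be
  listed separately, since right continuity gives nothing there.\<close>

lemma right_continuous_eq_on:
  fixes f g :: "real \<Rightarrow> 'a::t2_space"
  assumes f: "\<And>t. t \<in> {0..<T} \<Longrightarrow> (f \<longlongrightarrow> f t) (at_right t)"
    and g: "continuous_on {0..T} g"
    and eq: "\<And>t. t \<in> insert T (\<rat> \<inter> {0..T}) \<Longrightarrow> f t = g t"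
    and t: "t \<in> {0..T}"
  shows "f t = g t"
proof (cases "t = T")
  case False
  then have t': "t \<in> {0..<T}" using t by auto
  let ?F = "at t within (\<rat> \<inter> {t<..<T})"
  have nt: "?F \<noteq> bot"
  proof -
    have "\<exists>q\<in>\<rat> \<inter> {t<..<T}. q \<noteq> t \<and> dist q t < e" if "e > 0" for e
    proof -
      have "t < min T (t + e)" using t' that by simp
      from Rats_dense_in_real[OF this] obtain q where "q \<in> \<rat>" "t < q" "q < min T (t + e)" by blast
      then show ?thesis by (intro bexI[of _ q]) (auto simp: dist_real_def)
    qed
    then have "t islimpt (\<rat> \<inter> {t<..<T})" unfolding islimpt_approachable by blast
    then show ?thesis by (simp add: trivial_limit_within)
  qed
  have "(f \<longlongrightarrow> f t) ?F"
    by (rule tendsto_within_subset[OF f[OF t']]) auto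
  moreover have "(g \<longlongrightarrow> g t) ?F"
    by (rule tendsto_within_subset[where S = "{0..T}"]) (use g t t' in \<open>auto simp: continuous_on_def\<close>)
  moreover have "eventually (\<lambda>s. f s = g s) ?F"
    unfolding eventually_at_filter using eq t by (auto intro!: always_eventually)
  ultimately show ?thesis
    using tendsto_unique[OF nt Lim_transform_eventually] by blast
qed (use eq in simp)

text \<open>The common bound \<open>K\<close> turns convergence of \<open>d n\<close> to \<phi> into
  convergence of the pairings uniformly in \<open>t\<close>.\<close>

lemma continuous_on_blinfun_apply_closure:
  fixes A :: "real \<Rightarrow> 'c::real_normed_vector \<Rightarrow>\<^sub>L real"
  assumes cont: "\<And>d. d \<in> D \<Longrightarrow> continuous_on S (\<lambda>t. A t d)"
    and bound: "\<And>t. t \<in> S \<Longrightarrow> norm (A t) \<le> K" and \<phi>: "\<phi> \<in> closure D"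
  shows "continuous_on S (\<lambda>t. A t \<phi>)"
proof -
  obtain d where d: "\<And>n::nat. d n \<in> D" "d \<longlonglongrightarrow> \<phi>"
    using \<phi> unfolding closure_sequential by blast
  have "uniform_limit S (\<lambda>n t. A t (d n)) (\<lambda>t. A t \<phi>) sequentially"
  proof (rule uniform_limitI)
    fix e :: real assume "e > 0"
    then have "eventually (\<lambda>n. dist (d n) \<phi> < e / (\<bar>K\<bar> + 1)) sequentially"
      using d(2) by (intro tendstoD) auto
    then show "eventually (\<lambda>n. \<forall>t\<in>S. dist (A t (d n)) (A t \<phi>) < e) sequentially"
    proof eventually_elim
      case (elim n)
      show ?case
      proof
        fix t assume "t \<in> S"
        have "dist (A t (d n)) (A t \<phi>) \<le> norm (A t) * norm (d n - \<phi>)"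
          using norm_blinfun[of "A t" "d n - \<phi>"] by (simp add: dist_norm blinfun.diff_right)
        also have "\<dots> \<le> (\<bar>K\<bar> + 1) * norm (d n - \<phi>)"
          using bound[OF \<open>t \<in> S\<close>] by (intro mult_right_mono) auto
        also have "\<dots> < e" using elim by (simp add: dist_norm field_simps)
        finally show "dist (A t (d n)) (A t \<phi>) < e" .
      qed
    qed
  qed
  then show ?thesis
    by (rule uniform_limit_theorem[rotated]) (use cont d(1) in auto)
qed

section \<open>The chain rule\<close>

lemma continuous_on_ext_proc:
  assumes "cont_process M T X" "0 \<le> T" "\<omega> \<in> space M"
  shows "continuous_on UNIV (\<lambda>s. ext_proc T X s \<omega>)"
  unfolding ext_proc_def
  by (rule continuous_on_compose2[of "{0..T}" "\<lambda>t. X t \<omega>"])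
     (use assms in \<open>auto simp: cont_process_def intro!: continuous_intros\<close>)

lemma borel_measurable_ext_proc:
  "cont_process M T X \<Longrightarrow> 0 \<le> T \<Longrightarrow> ext_proc T X s \<in> borel_measurable M"
  unfolding ext_proc_def by (simp add: cont_process_def)

lemma ext_proc_eq: "s \<in> {0..T} \<Longrightarrow> ext_proc T X s = X s"
  by (simp add: ext_proc_def)

lemma borel_measurable_real_cov_eps:
  assumes "cont_process M T X" "cont_process M T Y" "0 \<le> T"
  shows "real_cov_eps T X Y \<epsilon> t \<in> borel_measurable M"
proof -
  have [measurable]: "ext_proc T X s \<in> borel_measurable M" "ext_proc T Y s \<in> borel_measurable M" for s
    using assms by (auto intro: borel_measurable_ext_proc)
  have cX: "continuous_on UNIV (\<lambda>s. ext_proc T Z (s + c) \<omega>)" if "cont_process M T Z" "\<omega> \<in> space M"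
    for c \<omega> and Z :: "real \<Rightarrow> 'a \<Rightarrow> real"
    by (rule continuous_on_compose2[OF continuous_on_ext_proc[OF that(1) assms(3) that(2)]])
       (auto intro!: continuous_intros)
  note cX0 = cX[where c = 0, unfolded add_0_right]
  show ?thesis
    unfolding real_cov_eps_def
  proof (rule borel_measurable_integral_continuous)
    fix \<omega> assume "\<omega> \<in> space M"
    then show "continuous_on UNIV (\<lambda>s. (ext_proc T X (s + \<epsilon>) \<omega> - ext_proc T X s \<omega>) *
        (ext_proc T Y (s + \<epsilon>) \<omega> - ext_proc T Y s \<omega>) / \<epsilon>)"
      unfolding divide_inverse
      by (intro continuous_on_mult continuous_on_diff cX cX0 assms continuous_on_const)
  qed measurable
qed

lemma cont_process_compose:
  assumes "cont_process M T X" "continuous_on UNIV F"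
  shows "cont_process M T (\<lambda>t \<omega>. F (X t \<omega>))"
  unfolding cont_process_def
proof (intro conjI ballI)
  fix t assume "t \<in> {0..T}"
  then have "X t \<in> borel_measurable M" using assms(1) by (simp add: cont_process_def)
  then show "(\<lambda>\<omega>. F (X t \<omega>)) \<in> borel_measurable M"
    by (rule measurable_compose[OF _ borel_measurable_continuous_onI[OF assms(2)]])
next
  fix \<omega> assume "\<omega> \<in> space M"
  then have "continuous_on {0..T} (\<lambda>t. X t \<omega>)" using assms(1) by (simp add: cont_process_def)
  then show "continuous_on {0..T} (\<lambda>t. F (X t \<omega>))"
    by (rule continuous_on_compose2[OF assms(2)]) simp
qed

lemma borel_measurable_grid_sum:
  fixes \<Gamma> :: "'b::real_normed_vector \<Rightarrow> 'b \<Rightarrow> 'c::real_normed_vector"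
    and A :: "real \<Rightarrow> 'w \<Rightarrow> 'c \<Rightarrow>\<^sub>L real"
  assumes D: "countable D" "closure D = (UNIV :: 'b set)"
    and X: "\<And>t. t \<in> {0..T} \<Longrightarrow> X t \<in> borel_measurable M"
    and Y: "\<And>t. t \<in> {0..T} \<Longrightarrow> Y t \<in> borel_measurable M"
    and A: "\<And>t. t \<in> {0..T} \<Longrightarrow> A t \<in> borel_measurable M"
    and \<Gamma>: "continuous_on UNIV (\<lambda>(a, b). \<Gamma> a b)"
    and t: "t \<in> {0..T}"
  shows "(\<lambda>\<omega>. grid_sum T (\<lambda>s. \<Gamma> (X s \<omega>) (Y s \<omega>)) (\<lambda>s. A s \<omega>) n t) \<in> borel_measurable M"
proof -
  have app: "(\<lambda>\<omega>. A r \<omega> \<phi>) \<in> borel_measurable M" if "r \<in> {0..T}" for r \<phi>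
    by (rule measurable_compose[OF A[OF that] borel_measurable_continuous_onI])
       (intro blinfun.continuous_on continuous_on_id continuous_on_const)
  have \<Gamma>1: "continuous_on UNIV (\<lambda>a. \<Gamma> a b)" and \<Gamma>2: "continuous_on UNIV (\<Gamma> b)" for b
    using continuous_on_compose2[OF \<Gamma>, of UNIV "\<lambda>a. (a, b)"] continuous_on_compose2[OF \<Gamma>, of UNIV "\<lambda>a. (b, a)"]
    by (simp_all add: continuous_on_Pair)
  have summand: "(\<lambda>\<omega>. A r \<omega> (\<Gamma> (X q \<omega>) (Y q \<omega>))) \<in> borel_measurable M"
    if "r \<in> {0..T}" "q \<in> {0..T}" for r q
  proof (rule borel_measurable_caratheodory[where g = "\<lambda>\<omega> b. A r \<omega> (\<Gamma> (X q \<omega>) b)", OF D Y[OF that(2)]])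
    show "(\<lambda>\<omega>. A r \<omega> (\<Gamma> (X q \<omega>) b)) \<in> borel_measurable M" for b
      by (rule borel_measurable_caratheodory[where g = "\<lambda>\<omega> a. A r \<omega> (\<Gamma> a b)", OF D X[OF that(2)] app[OF that(1)]])
         (intro blinfun.continuous_on continuous_on_const \<Gamma>1)
  qed (intro blinfun.continuous_on continuous_on_const \<Gamma>2)
  have g: "grid T n t k \<in> {0..T}" for k
    using grid_mem[of t T n k] t by auto
  show ?thesis
    unfolding grid_sum_def rs_sum_def blinfun.diff_left
    by (intro borel_measurable_sum borel_measurable_diff summand g)
qed

text \<open>The weak continuity of the \<open>\<chi>\<close>-covariation on the separable closure of a countable
  set \<open>D\<close> is enough for Riemann--Stieltjes integration of the integrands at hand; on all of
  \<open>\<chi>\<close> the exceptional null sets could not be united.\<close>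

lemma chi_covariation_regular_path:
  fixes A :: "real \<Rightarrow> 'c::real_normed_vector \<Rightarrow>\<^sub>L real"
  assumes "0 \<le> T" and "cadlag_on 0 T A" and "bounded_variation_on 0 T A"
    and g: "\<And>d. d \<in> D \<Longrightarrow> continuous_on {0..T} (g d)"
    and eq: "\<And>d t. d \<in> D \<Longrightarrow> t \<in> insert T (\<rat> \<inter> {0..T}) \<Longrightarrow> A t d = g d t"
  obtains v where "\<And>r s. 0 \<le> r \<Longrightarrow> r \<le> s \<Longrightarrow> s \<le> T \<Longrightarrow> norm (A s - A r) \<le> v s - v r"
    "\<And>d t. d \<in> D \<Longrightarrow> t \<in> {0..T} \<Longrightarrow> A t d = g d t"
    "\<And>\<phi>. \<phi> \<in> closure D \<Longrightarrow> continuous_on {0..T} (\<lambda>t. A t \<phi>)"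
proof -
  obtain v where v: "\<And>r s. 0 \<le> r \<Longrightarrow> r \<le> s \<Longrightarrow> s \<le> T \<Longrightarrow> norm (A s - A r) \<le> v s - v r"
    using bounded_variation_dominated[OF assms(3,1)] by blast
  have Ag: "A t d = g d t" if d: "d \<in> D" and t: "t \<in> {0..T}" for d t
  proof (rule right_continuous_eq_on[OF _ g[OF d] eq[OF d] t])
    fix s assume "s \<in> {0..<T}"
    then have "(A \<longlongrightarrow> A s) (at_right s)" using assms(2) unfolding cadlag_on_def by blast
    then show "((\<lambda>t. A t d) \<longlongrightarrow> A s d) (at_right s)" by (intro blinfun.tendsto tendsto_const)
  qed
  have bound: "norm (A t) \<le> norm (A 0) + (v T - v 0)" if "t \<in> {0..T}" for t
  proof -
    have "norm (A t - A 0) \<le> v t - v 0" "norm (A T - A t) \<le> v T - v t"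
      using v[of 0 t] v[of t T] that by auto
    then show ?thesis
      using norm_triangle_ineq2[of "A t" "A 0"] norm_ge_zero[of "A T - A t"] by linarith
  qed
  have "continuous_on {0..T} (\<lambda>t. A t d)" if "d \<in> D" for d
    using g[OF that] by (rule continuous_on_eq) (simp add: Ag that)
  then have "continuous_on {0..T} (\<lambda>t. A t \<phi>)" if "\<phi> \<in> closure D" for \<phi>
    using bound that by (rule continuous_on_blinfun_apply_closure)
  with v Ag that show ?thesis by blast
qed

lemma closure_dense_image:
  assumes "closure S = (UNIV :: 'a::topological_space set)" "continuous_on UNIV f"
  shows "f x \<in> closure (f ` S)"
  using image_closure_subset[of S f "closure (f ` S)"] assms closure_subset by fastforce

lemma chi_covariation_chain_rule:
  fixes M :: "'w measure" and \<iota> :: "'c::banach \<Rightarrow> 'b::banach \<Rightarrow> 'b \<Rightarrow> real"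
    and F G :: "'b \<Rightarrow> real"
  assumes M: "prob_space M" and T: "T > 0" and sep: "separable_space (euclidean :: 'b topology)"
    and chi: "chi_subspace \<iota>"
    and X: "cont_process M T X" and Y: "cont_process M T Y"
    and cov: "is_chi_covariation M T \<iota> X Y Cov A"
    and F: "\<And>a. (F has_derivative blinfun_apply (F' a)) (at a)"
    and G: "\<And>a. (G has_derivative blinfun_apply (G' a)) (at a)"
    and \<Gamma>: "\<And>a b. \<iota> (\<Gamma> a b) = (\<lambda>u w. F' a u * G' b w)"
    and \<Gamma>c: "continuous_on UNIV (\<lambda>(a, b). \<Gamma> a b)"
  shows "\<exists>C. is_real_covariation M T (\<lambda>t \<omega>. F (X t \<omega>)) (\<lambda>t \<omega>. G (Y t \<omega>)) C \<and>
    (\<forall>t\<in>{0..T}. AE \<omega> in M. has_rs_integral (\<lambda>s. \<Gamma> (X s \<omega>) (Y s \<omega>)) (\<lambda>s. A s \<omega>) 0 t (C t \<omega>))"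
proof -
  interpret prob_space M by fact
  have T0: "0 \<le> T" using T by simp
  obtain D0 :: "'b set" where D0: "countable D0" "closure D0 = UNIV"
    using sep unfolding separable_space_def by auto
  \<comment> \<open>\<open>D0 \<times> D0\<close> is dense in the product and \<Gamma> is
    continuous, so the closure of \<open>D\<close> contains every value of \<Gamma>, whatever the
    outcome.\<close>
  define D where "D = (\<lambda>(a, b). \<Gamma> a b) ` (D0 \<times> D0)"
  have D: "countable D" "D \<noteq> {}" using D0 unfolding D_def by auto
  have \<Gamma>D: "\<Gamma> a b \<in> closure D" for a b
    using closure_dense_image[of "D0 \<times> D0" "\<lambda>(a, b). \<Gamma> a b" "(a, b)"] \<Gamma>c D0(2)
    by (simp add: D_def closure_Times)
  have H1: "\<And>\<epsilon>::nat \<Rightarrow> real. (\<And>n. \<epsilon> n > 0) \<Longrightarrow> \<epsilon> \<longlonglongrightarrow> 0 \<Longrightarrow>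
        \<exists>r::nat \<Rightarrow> nat. strict_mono r \<and>
           (AE \<omega> in M. (SUP k. \<integral>\<^sup>+ s. indicator {0..T} s *
               ennreal (norm (chi_tensor \<iota> (ext_proc T X (s + \<epsilon> (r k)) \<omega> - ext_proc T X s \<omega>)
                                         (ext_proc T Y (s + \<epsilon> (r k)) \<omega> - ext_proc T Y s \<omega>)) / \<epsilon> (r k)) \<partial>lborel) < (\<top>::ennreal))"
    and Cov_cont: "\<And>\<phi>. cont_process M T (Cov \<phi>)"
    and H2: "\<And>\<phi>. unif_conv_in_prob M T (\<lambda>\<epsilon>. chi_cov_eps T \<iota> X Y \<phi> \<epsilon>) (Cov \<phi>) (at_right 0)"
    and A_joint: "(\<lambda>(t, \<omega>). A t \<omega>) \<in> borel_measurable (restrict_space borel {0..T} \<Otimes>\<^sub>M M)"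
    and A_reg: "AE \<omega> in M. cadlag_on 0 T (\<lambda>t. A t \<omega>) \<and> bounded_variation_on 0 T (\<lambda>t. A t \<omega>)"
    and A_Cov: "\<And>\<phi> t. t \<in> {0..T} \<Longrightarrow> AE \<omega> in M. A t \<omega> \<phi> = Cov \<phi> t \<omega>"
    using cov unfolding is_chi_covariation_def by blast+
  have A_meas: "A t \<in> borel_measurable M" if "t \<in> {0..T}" for t
    using measurable_Pair2[OF A_joint, of t] that by (simp add: space_restrict_space)
  \<comment> \<open>The identity in (H2) has an exceptional null set for each pair of a functional
    argument and a time. Countably many pairs suffice, as right continuity recovers the other
    times.\<close>
  define R where "R = insert T (\<rat> \<inter> {0..T})"
  have R: "countable R" "R \<subseteq> {0..T}" using T0 countable_rat by (auto simp: R_def)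
  have "AE \<omega> in M. \<forall>d\<in>D. \<forall>t\<in>R. A t \<omega> d = Cov d t \<omega>"
    using D(1) R A_Cov by (auto simp: AE_ball_countable)
  with A_reg have "AE \<omega> in M. (cadlag_on 0 T (\<lambda>t. A t \<omega>) \<and> bounded_variation_on 0 T (\<lambda>t. A t \<omega>))
      \<and> (\<forall>d\<in>D. \<forall>t\<in>R. A t \<omega> d = Cov d t \<omega>)" by (rule AE_conjI)
  \<comment> \<open>The process \<open>C\<close> must be measurable at each time and continuous for
    every outcome, not just almost surely. It is therefore set to \<open>0\<close> on a measurable
    null set \<open>N\<close> that contains all irregular outcomes.\<close>
  then obtain N where N: "{\<omega> \<in> space M. \<not> ((cadlag_on 0 T (\<lambda>t. A t \<omega>) \<and> bounded_variation_on 0 T (\<lambda>t. A t \<omega>))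
      \<and> (\<forall>d\<in>D. \<forall>t\<in>R. A t \<omega> d = Cov d t \<omega>))} \<subseteq> N" "emeasure M N = 0" "N \<in> sets M"
    by (rule AE_E)
  have AE_N: "AE \<omega> in M. \<omega> \<notin> N" using N by (intro AE_not_in) auto
  define H where "H \<omega> s = \<Gamma> (X s \<omega>) (Y s \<omega>)" for \<omega> s
  define C where "C t \<omega> = (if \<omega> \<in> N then 0 else lim (\<lambda>n. grid_sum T (H \<omega>) (\<lambda>s. A s \<omega>) n t))" for t \<omega>
  have Hc: "continuous_on {0..T} (H \<omega>)" if "\<omega> \<in> space M" for \<omega>
    unfolding H_def using X Y that continuous_on_compose2[OF \<Gamma>c, of "{0..T}" "\<lambda>s. (X s \<omega>, Y s \<omega>)"]
    by (simp add: cont_process_def continuous_on_Pair)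
  have reg: "\<exists>v. (\<forall>r s. 0 \<le> r \<longrightarrow> r \<le> s \<longrightarrow> s \<le> T \<longrightarrow> norm (A s \<omega> - A r \<omega>) \<le> v s - v r) \<and>
     (\<forall>d\<in>D. \<forall>t\<in>{0..T}. A t \<omega> d = Cov d t \<omega>) \<and>
     (\<forall>\<phi>\<in>closure D. continuous_on {0..T} (\<lambda>t. A t \<omega> \<phi>))"
    if "\<omega> \<in> space M" "\<omega> \<notin> N" for \<omega>
  proof -
    have *: "cadlag_on 0 T (\<lambda>t. A t \<omega>)" "bounded_variation_on 0 T (\<lambda>t. A t \<omega>)"
      "\<And>d t. d \<in> D \<Longrightarrow> t \<in> insert T (\<rat> \<inter> {0..T}) \<Longrightarrow> A t \<omega> d = Cov d t \<omega>"
      using that N(1) unfolding R_def by blast+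
    have "continuous_on {0..T} (\<lambda>t. Cov d t \<omega>)" for d
      using Cov_cont[of d] that(1) by (simp add: cont_process_def)
    from chi_covariation_regular_path[OF T0 *(1,2) this *(3)] show ?thesis by metis
  qed
  have C_meas: "C t \<in> borel_measurable M" if t: "t \<in> {0..T}" for t
  proof (rule borel_measurable_LIMSEQ_real)
    show "(\<lambda>\<omega>. if \<omega> \<in> N then 0 else grid_sum T (H \<omega>) (\<lambda>s. A s \<omega>) n t) \<in> borel_measurable M" for n
      unfolding H_def
      by (intro measurable_If_set borel_measurable_const borel_measurable_grid_sum[OF D0 _ _ A_meas \<Gamma>c t])
         (use X Y N(3) in \<open>auto simp: cont_process_def\<close>)
  next
    fix \<omega> assume \<omega>: "\<omega> \<in> space M"
    show "(\<lambda>n. if \<omega> \<in> N then 0 else grid_sum T (H \<omega>) (\<lambda>s. A s \<omega>) n t) \<longlonglongrightarrow> C t \<omega>"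
    proof (cases "\<omega> \<in> N")
      case False
      obtain v where "\<And>r s. 0 \<le> r \<Longrightarrow> r \<le> s \<Longrightarrow> s \<le> T \<Longrightarrow> norm (A s \<omega> - A r \<omega>) \<le> v s - v r"
        using reg[OF \<omega> False] by blast
      from tendsto_uniform_limitI[OF grid_sum_converges(1)[OF this Hc[OF \<omega>]] t]
      show ?thesis using False by (simp add: C_def)
    qed (simp add: C_def)
  qed
  have C_cont: "continuous_on {0..T} (\<lambda>t. C t \<omega>)" if \<omega>: "\<omega> \<in> space M" for \<omega>
  proof (cases "\<omega> \<in> N")
    case False
    obtain v where v: "\<And>r s. 0 \<le> r \<Longrightarrow> r \<le> s \<Longrightarrow> s \<le> T \<Longrightarrow> norm (A s \<omega> - A r \<omega>) \<le> v s - v r"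
      and cl: "\<And>\<phi>. \<phi> \<in> closure D \<Longrightarrow> continuous_on {0..T} (\<lambda>t. A t \<omega> \<phi>)"
      using reg[OF \<omega> False] by blast
    have "continuous_on {0..T} (\<lambda>t. lim (\<lambda>n. grid_sum T (H \<omega>) (\<lambda>s. A s \<omega>) n t))"
      by (rule continuous_on_rs_limit[OF v Hc[OF \<omega>] T0 cl]) (simp_all add: H_def \<Gamma>D)
    then show ?thesis using False by (simp add: C_def)
  qed (simp add: C_def)
  have rs: "AE \<omega> in M. has_rs_integral (\<lambda>s. \<Gamma> (X s \<omega>) (Y s \<omega>)) (\<lambda>s. A s \<omega>) 0 t (C t \<omega>)"
    if t: "t \<in> {0..T}" for t
    using AE_N AE_space
  proof eventually_elim
    case (elim \<omega>)
    obtain v where "\<And>r s. 0 \<le> r \<Longrightarrow> r \<le> s \<Longrightarrow> s \<le> T \<Longrightarrow> norm (A s \<omega> - A r \<omega>) \<le> v s - v r"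
      using reg[OF elim(2,1)] by blast
    from grid_sum_converges(2)[OF this Hc[OF elim(2)] t] show ?case
      using elim by (simp add: C_def H_def[abs_def])
  qed
  have Fc: "continuous_on UNIV F" and Gc: "continuous_on UNIV G"
    using F G by (auto intro!: continuous_at_imp_continuous_on has_derivative_continuous)
  let ?FX = "\<lambda>t \<omega>. F (X t \<omega>)" and ?GY = "\<lambda>t \<omega>. G (Y t \<omega>)"
  have conv: "conv_in_prob M (\<lambda>\<epsilon>. real_cov_eps T ?FX ?GY \<epsilon> t) (C t) (at_right 0)" if t: "t \<in> {0..T}" for t
  proof (rule conv_in_prob_at_rightI[OF M _ C_meas[OF t]])
    show "real_cov_eps T ?FX ?GY \<epsilon> t \<in> borel_measurable M" for \<epsilon>
      by (rule borel_measurable_real_cov_eps[OF cont_process_compose[OF X Fc] cont_process_compose[OF Y Gc] T0])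
  next
    fix \<epsilon> :: "nat \<Rightarrow> real" assume \<epsilon>: "\<And>n. 0 < \<epsilon> n" "\<epsilon> \<longlonglongrightarrow> 0"
    define I where "I e \<omega> = (\<integral>\<^sup>+ s. indicator {0..T} s *
               ennreal (norm (chi_tensor \<iota> (ext_proc T X (s + e) \<omega> - ext_proc T X s \<omega>)
                                         (ext_proc T Y (s + e) \<omega> - ext_proc T Y s \<omega>)) / e) \<partial>lborel)" for e \<omega>
    \<comment> \<open>The subsequence for (H1) comes first: its bound is a supremum over all
      \<open>k\<close> and survives the further extraction \<open>r2\<close> made for (H2).\<close>
    obtain r1 :: "nat \<Rightarrow> nat" where r1: "strict_mono r1"
      "AE \<omega> in M. (SUP k. I (\<epsilon> (r1 k)) \<omega>) < \<top>"
      using H1[OF \<epsilon>] unfolding I_def by blast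
    have \<epsilon>1: "\<And>n. 0 < \<epsilon> (r1 n)" "(\<lambda>n. \<epsilon> (r1 n)) \<longlonglongrightarrow> 0"
      using \<epsilon>(1) LIMSEQ_subseq_LIMSEQ[OF \<epsilon>(2) r1(1)] by (simp_all only: o_def)
    obtain r2 :: "nat \<Rightarrow> nat" where r2: "strict_mono r2"
      "AE \<omega> in M. \<forall>m. \<forall>t\<in>{0..T}. (\<lambda>k. chi_cov_eps T \<iota> X Y (from_nat_into D m) (\<epsilon> (r1 (r2 k))) t \<omega>)
         \<longlonglongrightarrow> Cov (from_nat_into D m) t \<omega>"
      using unif_conv_in_prob_AE_subsequence[OF M H2 \<epsilon>1] by blast
    have \<epsilon>2: "(\<lambda>n. \<epsilon> (r1 (r2 n))) \<longlonglongrightarrow> 0"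
      using LIMSEQ_subseq_LIMSEQ[OF \<epsilon>1(2) r2(1)] by (simp only: o_def)
    have "AE \<omega> in M. (\<lambda>k. real_cov_eps T ?FX ?GY (\<epsilon> (r1 (r2 k))) t \<omega>) \<longlonglongrightarrow> C t \<omega>"
      using AE_N AE_space r1(2) r2(2)
    proof eventually_elim
      case (elim \<omega>)
      obtain v where v: "\<And>r s. 0 \<le> r \<Longrightarrow> r \<le> s \<Longrightarrow> s \<le> T \<Longrightarrow> norm (A s \<omega> - A r \<omega>) \<le> v s - v r"
        and Ad: "\<And>d t. d \<in> D \<Longrightarrow> t \<in> {0..T} \<Longrightarrow> A t \<omega> d = Cov d t \<omega>"
        using reg[OF elim(2,1)] by blast
      define x where "x s = ext_proc T X s \<omega>" for s
      define y where "y s = ext_proc T Y s \<omega>" for s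
      have xy: "continuous_on UNIV x" "continuous_on UNIV y"
        unfolding x_def y_def
        by (rule continuous_on_ext_proc[OF X T0 elim(2)] continuous_on_ext_proc[OF Y T0 elim(2)])+
      have xyc: "continuous_on S (\<lambda>s. x (s + c) - x s)" "continuous_on S (\<lambda>s. y (s + c) - y s)" for S c
        by (intro continuous_on_diff continuous_on_subset[OF xy(1)] continuous_on_subset[OF xy(2)]
             continuous_on_compose2[OF xy(1)] continuous_on_compose2[OF xy(2)] continuous_on_add
             continuous_on_id continuous_on_const subset_UNIV)+
      \<comment> \<open>\<open>K\<close> depends on the outcome, which is harmless since the
        convergence is pathwise; the conversion to a real number is faithful because the supremum is
        finite.\<close>
      define K where "K = enn2real (SUP k. I (\<epsilon> (r1 k)) \<omega>)"
      have IK: "I (\<epsilon> (r1 k)) \<omega> \<le> ennreal K" for k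
        using elim(3) SUP_upper[of k UNIV "\<lambda>k. I (\<epsilon> (r1 k)) \<omega>"] by (simp add: K_def)
      have bound: "integral {0..T} (\<lambda>s. norm (chi_tensor \<iota> (x (s + \<epsilon> (r1 (r2 k))) - x s)
          (y (s + \<epsilon> (r1 (r2 k))) - y s)) / \<epsilon> (r1 (r2 k))) \<le> K" for k
      proof (rule integral_le_of_nn_integral_le)
        show "continuous_on {0..T} (\<lambda>s. norm (chi_tensor \<iota> (x (s + \<epsilon> (r1 (r2 k))) - x s)
          (y (s + \<epsilon> (r1 (r2 k))) - y s)) / \<epsilon> (r1 (r2 k)))"
          unfolding divide_inverse
          by (intro continuous_on_mult continuous_on_norm continuous_on_const xyc
                bounded_bilinear.continuous_on[OF bounded_bilinear_chi_tensor[OF chi]])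
      qed (use \<epsilon>(1) IK in \<open>auto simp: I_def x_def y_def K_def less_imp_le\<close>)
      have lim: "(\<lambda>k. integral {0..s} (\<lambda>q. \<iota> d (x (q + \<epsilon> (r1 (r2 k))) - x q)
          (y (q + \<epsilon> (r1 (r2 k))) - y q) / \<epsilon> (r1 (r2 k)))) \<longlonglongrightarrow> A s \<omega> d"
        if "d \<in> D" "s \<in> {0..T}" for d s
      proof -
        obtain m where "d = from_nat_into D m"
          using from_nat_into_surj[OF D(1) \<open>d \<in> D\<close>] by metis
        then show ?thesis
          using elim(4) that Ad[OF that] by (simp add: chi_cov_eps_def x_def y_def)
      qed
      have "(\<lambda>k. integral {0..t} (\<lambda>s. (F (x (s + \<epsilon> (r1 (r2 k)))) - F (x s)) *
            (G (y (s + \<epsilon> (r1 (r2 k)))) - G (y s)) / \<epsilon> (r1 (r2 k))))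
        \<longlonglongrightarrow> lim (\<lambda>n. grid_sum T (\<lambda>s. \<Gamma> (x s) (y s)) (\<lambda>s. A s \<omega>) n t)"
        by (rule path_covariation_tendsto[OF chi F G \<Gamma> \<Gamma>c xy \<epsilon>2 \<epsilon>(1) v bound \<Gamma>D lim t])
      \<comment> \<open>Here \<open>x\<close> and \<open>y\<close> are the paths extended to all
        real times, whereas \<open>H\<close> uses the original ones; they agree at the grid nodes,
        which lie in \<open>{0..T}\<close>.\<close>
      moreover have "grid_sum T (\<lambda>s. \<Gamma> (x s) (y s)) (\<lambda>s. A s \<omega>) n t = grid_sum T (H \<omega>) (\<lambda>s. A s \<omega>) n t" for n
      proof -
        have "grid T n t k \<in> {0..T}" for k using grid_mem[of t T n k] t by auto
        then show ?thesis
          by (simp add: grid_sum_def rs_sum_def H_def x_def y_def ext_proc_eq)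
      qed
      ultimately show ?case
        using elim(1) by (simp add: C_def real_cov_eps_def x_def y_def ext_proc_def)
    qed
    then show "\<exists>r::nat \<Rightarrow> nat. strict_mono r \<and> (AE \<omega> in M. (\<lambda>k. real_cov_eps T ?FX ?GY (\<epsilon> (r k)) t \<omega>) \<longlonglongrightarrow> C t \<omega>)"
      using strict_mono_o[OF r1(1) r2(1)] by (intro exI[of _ "r1 \<circ> r2"]) simp
  qed
  have "is_real_covariation M T ?FX ?GY C"
    unfolding is_real_covariation_def cont_process_def using C_meas C_cont conv by blast
  with rs show ?thesis by blast
qed

theorem theorem4p6:
  fixes M :: "'w measure" and T :: real
    and \<iota> :: "'c::banach \<Rightarrow> 'b::banach \<Rightarrow> 'b \<Rightarrow> real"
    and X :: "nat \<Rightarrow> real \<Rightarrow> 'w \<Rightarrow> 'b"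
    and Cov :: "nat \<Rightarrow> nat \<Rightarrow> 'c \<Rightarrow> real \<Rightarrow> 'w \<Rightarrow> real"
    and Tl :: "nat \<Rightarrow> nat \<Rightarrow> real \<Rightarrow> 'w \<Rightarrow> ('c \<Rightarrow>\<^sub>L real)"
    and F :: "nat \<Rightarrow> 'b \<Rightarrow> real" and DF :: "nat \<Rightarrow> 'b \<Rightarrow> ('b \<Rightarrow>\<^sub>L real)"
    and G :: "nat \<Rightarrow> nat \<Rightarrow> 'b \<Rightarrow> 'b \<Rightarrow> 'c"
  assumes "prob_space M" and "T > 0"
    and "separable_space (euclidean :: 'b topology)"
    and "chi_subspace \<iota>"
    and "\<forall>i\<in>{1,2}. cont_process M T (X i)"
    and "\<forall>i\<in>{1,2}. \<forall>j\<in>{1,2}. is_chi_covariation M T \<iota> (X i) (X j) (Cov i j) (Tl i j)"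
    and "\<forall>i\<in>{1,2}. \<forall>x. (F i has_derivative blinfun_apply (DF i x)) (at x)"
    and "\<forall>i\<in>{1,2}. continuous_on UNIV (DF i)"
    and "\<forall>i\<in>{1,2}. \<forall>j\<in>{1,2}. \<forall>x y. \<iota> (G i j x y) = (\<lambda>a b. DF i x a * DF j y b)"
    and "\<forall>i\<in>{1,2}. \<forall>j\<in>{1,2}. continuous_on UNIV (\<lambda>(x, y). G i j x y)"
  shows "\<forall>i\<in>{1,2}. \<forall>j\<in>{1,2}. \<exists>C.
           is_real_covariation M T (\<lambda>t \<omega>. F i (X i t \<omega>)) (\<lambda>t \<omega>. F j (X j t \<omega>)) C \<and>
           (\<forall>t\<in>{0..T}. AE \<omega> in M.
              has_rs_integral (\<lambda>s. G i j (X i s \<omega>) (X j s \<omega>)) (\<lambda>s. Tl i j s \<omega>) 0 t (C t \<omega>))"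
proof (intro ballI)
  fix i j :: nat assume i: "i \<in> {1, 2}" and j: "j \<in> {1, 2}"
  show "\<exists>C. is_real_covariation M T (\<lambda>t \<omega>. F i (X i t \<omega>)) (\<lambda>t \<omega>. F j (X j t \<omega>)) C \<and>
           (\<forall>t\<in>{0..T}. AE \<omega> in M.
              has_rs_integral (\<lambda>s. G i j (X i s \<omega>) (X j s \<omega>)) (\<lambda>s. Tl i j s \<omega>) 0 t (C t \<omega>))"
    by (rule chi_covariation_chain_rule[where F' = "DF i" and G' = "DF j" and Cov = "Cov i j" and \<iota> = \<iota>])
       (use assms i j in blast)+
qed

end
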